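(* Let $d\in\mathbb{N}$, let $\mathcal{I}$ be a countably infinite index set with a $d$-regular partition $\mathscr{P}=(\mathcal{I}_m)_{m\in\mathbb{N}}$. Let $p,q\in(0,\infty]$ and $\alpha\in\mathbb{R}$ with $\alpha>d\cdot(\frac12-\frac1p)_+$. Then $\mathcal{S}:=\mathcal{B}(0,1;\ell^{p,q}_\alpha(\mathscr{P}))\subset\ell^2(\mathcal{I})$ is compact (hence Borel measurable), its optimal compression rate is $s^\ast_{\ell^2(\mathcal{I})}(\mathcal{S})=\frac{\alpha}{d}-(\frac12-\frac1p)$, and there exists a Borel probability measure on $\mathcal{S}$ that is critical for $\mathcal{S}$ with respect to $\ell^2(\mathcal{I})$.
   Context: A partition $\mathscr{P}=(\mathcal{I}_m)_{m\in\mathbb{N}}$ of a countably infinite set $\mathcal{I}$ (disjoint union $\mathcal{I}=\biguplus_m\mathcal{I}_m$) is $d$-regular if there are $0<a<A<\infty$ with $a2^{dm}\le|\mathcal{I}_m|\le A2^{dm}$ for all $m\in\mathbb{N}$. For $\mathbf{x}\in\mathbb{R}^{\mathcal{I}}$ let $\mathbf{x}_m=(x_i)_{i\in\mathcal{I}_m}$ and $\|\mathbf{x}\|_{\ell^{p,q}_\alpha(\mathscr{P})}=\|(2^{\alpha m}\|\mathbf{x}_m\|_{\ell^p(\mathcal{I}_m)})_{m\in\mathbb{N}}\|_{\ell^q(\mathbb{N})}$; $\ell^{p,q}_\alpha(\mathscr{P})$ is the set of real sequences with finite quasi-norm, and $\mathcal{B}(0,1;\cdot)$ its closed unit ball. Rate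 distortion notions for a Banach space $\mathbf{X}$ and $\mathcal{S}\subset\mathbf{X}$: a codec is a sequence $((E_R,D_R))_{R}$, $E_R:\mathcal{S}\to\{0,1\}^R$, $D_R:\{0,1\}^R\to\mathbf{X}$, with distortion $\delta(E_R,D_R)=\sup_{\mathbf{x}\in\mathcal{S}}\|\mathbf{x}-D_R(E_R(\mathbf{x}))\|_{\mathbf{X}}$; $s^\ast_{\mathbf{X}}(\mathcal{S})=\sup\{s\ge0:\exists\text{ codec with }\sup_RR^s\delta(E_R,D_R)<\infty\}$. A Borel probability measure $\mathbb{P}$ on $\mathcal{S}$ (trace Borel $\sigma$-algebra) has growth order $s_0$ if for every $s>s_0$ there are $\varepsilon_0,c>0$ with $\mathbb{P}(\mathcal{S}\cap\mathcal{B}(\mathbf{x},\varepsilon;\mathbf{X}))\le2^{-c\varepsilon^{-1/s}}$ for all $\mathbf{x}\in\mathbf{X}$, $\varepsilon\in(0,\varepsilon_0)$; it is critical if $s_0=s^\ast_{\mathbf{X}}(\mathcal{S})$. *)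

theory Defs
  imports "HOL-Analysis.Analysis" "HOL-Probability.Probability"
begin

definition is_partition :: "(nat \<Rightarrow> 'i set) \<Rightarrow> bool" where
  "is_partition P \<longleftrightarrow> disjoint_family P \<and> (\<Union>m. P m) = UNIV"

definition d_regular :: "nat \<Rightarrow> (nat \<Rightarrow> 'i set) \<Rightarrow> bool" where
  "d_regular d P \<longleftrightarrow> is_partition P \<and>
     (\<exists>a A::real. 0 < a \<and> a < A \<and>
        (\<forall>m. finite (P m) \<and> a * 2 ^ (d * m) \<le> real (card (P m))
                        \<and> real (card (P m)) \<le> A * 2 ^ (d * m)))"

text \<open>Exponents p, q range over (0, \<infinity>] and are modelled as ennreal; \<infinity> = top.\<close>

definition inv_exp :: "ennreal \<Rightarrow> real" where
  "inv_exp p = (if p = \<infinity> then 0 else 1 / enn2real p)"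

definition lp_norm_fin :: "ennreal \<Rightarrow> 'i set \<Rightarrow> ('i \<Rightarrow> real) \<Rightarrow> real" where
  "lp_norm_fin p B x =
     (if p = \<infinity> then (if B = {} then 0 else Max ((\<lambda>i. \<bar>x i\<bar>) ` B))
      else (\<Sum>i\<in>B. \<bar>x i\<bar> powr enn2real p) powr (1 / enn2real p))"

definition mixed_norm :: "ennreal \<Rightarrow> ennreal \<Rightarrow> real \<Rightarrow> (nat \<Rightarrow> 'i set) \<Rightarrow> ('i \<Rightarrow> real) \<Rightarrow> ennreal" where
  "mixed_norm p q \<alpha> P x =
     (let a = (\<lambda>m. 2 powr (\<alpha> * real m) * lp_norm_fin p (P m) x) in
      if q = \<infinity> then (SUP m. ennreal (a m))
      else (let s = (\<Sum>m. ennreal (a m powr enn2real q)) in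
            if s = \<infinity> then \<infinity> else ennreal (enn2real s powr (1 / enn2real q))))"

definition mixed_unit_ball :: "ennreal \<Rightarrow> ennreal \<Rightarrow> real \<Rightarrow> (nat \<Rightarrow> 'i set) \<Rightarrow> ('i \<Rightarrow> real) set" where
  "mixed_unit_ball p q \<alpha> P = {x. mixed_norm p q \<alpha> P x \<le> 1}"

definition l2space :: "('i \<Rightarrow> real) set" where
  "l2space = {x. (\<lambda>i. (x i)\<^sup>2) summable_on UNIV}"

definition l2dist :: "('i \<Rightarrow> real) \<Rightarrow> ('i \<Rightarrow> real) \<Rightarrow> real" where
  "l2dist x y = sqrt (\<Sum>\<^sub>\<infinity>i. (x i - y i)\<^sup>2)"

definition l2top :: "('i \<Rightarrow> real) topology" where
  "l2top = Metric_space.mtopology l2space l2dist"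

definition l2borel :: "('i \<Rightarrow> real) measure" where
  "l2borel = sigma l2space {U. openin l2top U}"

definition codec_achieves :: "('i \<Rightarrow> real) set \<Rightarrow> real \<Rightarrow> bool" where
  "codec_achieves S s \<longleftrightarrow>
     (\<exists>(E :: nat \<Rightarrow> ('i \<Rightarrow> real) \<Rightarrow> bool list) (D :: nat \<Rightarrow> bool list \<Rightarrow> ('i \<Rightarrow> real)) C.
        (\<forall>R. \<forall>x\<in>S. length (E R x) = R) \<and>
        (\<forall>R bs. length bs = R \<longrightarrow> D R bs \<in> l2space) \<and>
        (\<forall>R\<ge>1. \<forall>x\<in>S. real R powr s * l2dist x (D R (E R x)) \<le> C))"

definition opt_rate :: "('i \<Rightarrow> real) set \<Rightarrow> ereal" where
  "opt_rate S = Sup (ereal ` {s. 0 \<le> s \<and> codec_achieves S s})"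

definition borel_prob_on :: "('i \<Rightarrow> real) set \<Rightarrow> ('i \<Rightarrow> real) measure \<Rightarrow> bool" where
  "borel_prob_on S M \<longleftrightarrow> prob_space M \<and> space M = S \<and>
      sets M = sets (restrict_space l2borel S)"

definition growth_order :: "('i \<Rightarrow> real) set \<Rightarrow> ('i \<Rightarrow> real) measure \<Rightarrow> real \<Rightarrow> bool" where
  "growth_order S M s0 \<longleftrightarrow>
     (\<forall>s>s0. \<exists>\<epsilon>0>0. \<exists>c>0. \<forall>x\<in>l2space. \<forall>\<epsilon>. 0 < \<epsilon> \<and> \<epsilon> < \<epsilon>0 \<longrightarrow>
        measure M (S \<inter> {y\<in>l2space. l2dist x y \<le> \<epsilon>}) \<le> 2 powr (- c * \<epsilon> powr (- 1 / s)))"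

definition critical :: "('i \<Rightarrow> real) set \<Rightarrow> ('i \<Rightarrow> real) measure \<Rightarrow> bool" where
  "critical S M \<longleftrightarrow> (\<exists>s0. opt_rate S = ereal s0 \<and> growth_order S M s0)"

end

theory Submission
  imports Defs
begin

text \<open>
  Up to constants the unit ball lies in a set of sequences whose \<open>m\<close>-th block has \<open>\<ell>\<^sup>r\<close>-norm at most
  \<open>2\<^sup>-\<^sup>\<beta>\<^sup>m\<close>, with \<open>r \<le> 2\<close> and the same critical exponent \<open>s\<^sub>0\<close> (for \<open>p > 2\<close> one passes to \<open>r = 2\<close>).
  On such a set the \<open>\<ell>\<^sup>2\<close> topology is the product topology, and compactness follows from
  Tychonoff's theorem.

  For the codec with budget parameter \<open>J\<close>, all entries of the blocks up to \<open>J\<close> are kept; in each of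
  the following blocks, up to a multiple \<open>K J\<close> of \<open>J\<close>, only the entries above a threshold exceeded by
  at most \<open>2\<^sup>d\<^sup>J\<close> of them are kept. The kept entries are rounded to a grid. This costs
  \<open>O(J\<^sup>2 2\<^sup>d\<^sup>J)\<close> bits and has error \<open>O(2\<close> to the power \<open>- d J s\<^sub>0)\<close>; the factor \<open>J\<^sup>2\<close> does not
  affect the rate.

  The critical measure is the law of random signs, scaled on block \<open>m\<close> so that the block norms
  equal a sequence of polynomial decay in the unit ball of \<open>\<ell>\<^sup>q\<close>. A Chernoff bound on a single block
  shows that small balls have small measure, and a union bound over the \<open>2\<^sup>R\<close> reconstruction points
  of a codec then excludes every rate above \<open>s\<^sub>0\<close>.
\<close>

section \<open>The metric space of square-summable sequences\<close>

lemma sum_squares_le_infsum: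
  fixes z :: "'i \<Rightarrow> real"
  assumes "(\<lambda>i. (z i)\<^sup>2) summable_on UNIV" "finite F"
  shows "(\<Sum>i\<in>F. (z i)\<^sup>2) \<le> (\<Sum>\<^sub>\<infinity>i. (z i)\<^sup>2)"
  by (rule finite_sum_le_infsum) (use assms in auto)

lemma power2_diff_le: "(x - y)\<^sup>2 \<le> 2 * x\<^sup>2 + 2 * (y::real)\<^sup>2"
  using zero_le_power2[of "x + y"] by (simp add: power2_eq_square algebra_simps)

lemma l2space_minus:
  assumes "x \<in> l2space" "y \<in> l2space"
  shows "(\<lambda>i. (x i - y i)\<^sup>2) summable_on UNIV"
proof (rule summable_on_comparison_test)
  show "(\<lambda>i. 2 * (x i)\<^sup>2 + 2 * (y i)\<^sup>2) summable_on UNIV"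
    using assms unfolding l2space_def by (intro summable_on_add summable_on_cmult_right) auto
  show "(x i - y i)\<^sup>2 \<le> 2 * (x i)\<^sup>2 + 2 * (y i)\<^sup>2" for i
    by (rule power2_diff_le)
qed auto

lemma zero_in_l2space [simp]: "(\<lambda>_. 0) \<in> l2space"
  by (simp add: l2space_def)

lemma L2_set_le_l2dist:
  assumes "x \<in> l2space" "y \<in> l2space" "finite F"
  shows "L2_set (\<lambda>i. x i - y i) F \<le> l2dist x y"
  unfolding L2_set_def l2dist_def
  using sum_squares_le_infsum[OF l2space_minus[OF assms(1,2)] assms(3)] by simp

lemma l2dist_nonneg: "0 \<le> l2dist x y"
  by (simp add: l2dist_def infsum_nonneg)

lemma l2dist_le:
  assumes "0 \<le> c" "\<And>F. finite F \<Longrightarrow> (\<Sum>i\<in>F. (x i - y i)\<^sup>2) \<le> c\<^sup>2"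
    and "x \<in> l2space" "y \<in> l2space"
  shows "l2dist x y \<le> c"
proof -
  have "(\<Sum>\<^sub>\<infinity>i. (x i - y i)\<^sup>2) \<le> c\<^sup>2"
    by (rule infsum_le_finite_sums) (use assms l2space_minus in auto)
  then show ?thesis unfolding l2dist_def using assms(1) by (simp add: real_le_lsqrt)
qed

lemma l2dist_triangle:
  assumes "x \<in> l2space" "y \<in> l2space" "z \<in> l2space"
  shows "l2dist x z \<le> l2dist x y + l2dist y z"
proof (rule l2dist_le)
  fix F :: "'a set" assume F: "finite F"
  have "L2_set (\<lambda>i. x i - z i) F \<le> L2_set (\<lambda>i. x i - y i) F + L2_set (\<lambda>i. y i - z i) F"
    using L2_set_triangle_ineq[of "\<lambda>i. x i - y i" "\<lambda>i. y i - z i" F] by simp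
  also have "\<dots> \<le> l2dist x y + l2dist y z"
    by (intro add_mono L2_set_le_l2dist assms F)
  finally have "(L2_set (\<lambda>i. x i - z i) F)\<^sup>2 \<le> (l2dist x y + l2dist y z)\<^sup>2"
    by (intro power_mono) auto
  then show "(\<Sum>i\<in>F. (x i - z i)\<^sup>2) \<le> (l2dist x y + l2dist y z)\<^sup>2"
    by (simp add: L2_set_def sum_nonneg)
qed (use assms l2dist_nonneg in \<open>auto intro: add_nonneg_nonneg\<close>)

interpretation l2: Metric_space l2space l2dist
proof
  show "l2dist x y = l2dist y x" for x y :: "'a \<Rightarrow> real"
    by (simp add: l2dist_def power2_commute)
  show "l2dist x y = 0 \<longleftrightarrow> x = y" if "x \<in> l2space" "y \<in> l2space" for x y :: "'a \<Rightarrow> real"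
  proof
    assume 0: "l2dist x y = 0"
    have "\<bar>x i - y i\<bar> \<le> 0" for i
      using L2_set_le_l2dist[OF that, of "{i}"] 0 by (simp add: L2_set_def)
    then show "x = y" by (intro ext) simp
  qed (simp add: l2dist_def)
qed (auto intro: l2dist_nonneg l2dist_triangle)

lemma topspace_l2top [simp]: "topspace l2top = l2space"
  by (simp add: l2top_def)

lemma space_l2borel [simp]: "space l2borel = l2space"
  unfolding l2borel_def using openin_subset[of l2top] by (subst space_measure_of) auto

lemma sets_l2borel: "sets l2borel = sigma_sets l2space {U. openin l2top U}"
  unfolding l2borel_def using openin_subset[of l2top] by (subst sets_measure_of) auto

lemma openin_sets_l2borel: "openin l2top U \<Longrightarrow> U \<in> sets l2borel"
  by (simp add: sets_l2borel)

lemma closedin_sets_l2borel: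
  assumes "closedin l2top U" shows "U \<in> sets l2borel"
proof -
  have "U = space l2borel - (topspace l2top - U)"
    using closedin_subset[OF assms] by auto
  moreover have "topspace l2top - U \<in> sets l2borel"
    using assms unfolding closedin_def by (intro openin_sets_l2borel) blast
  ultimately show ?thesis by (metis sets.compl_sets)
qed

lemma closed_ball_sets_l2borel:
  assumes "x \<in> l2space" shows "{y \<in> l2space. l2dist x y \<le> r} \<in> sets l2borel"
proof -
  have "{y \<in> l2space. l2dist x y \<le> r} = l2.mcball x r"
    using assms by (auto simp: l2.mcball_def)
  then show ?thesis
    by (auto intro: closedin_sets_l2borel simp: l2top_def)
qed

section \<open>Sequences over a partition into finite blocks\<close>

locale finite_blocks =
  fixes P :: "nat \<Rightarrow> 'i set"
  assumes finite_block: "finite (P m)" and disjoint_blocks: "disjoint_family P"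
    and blocks_cover: "(\<Union>m. P m) = UNIV"
begin

lemma finite_subset_blocks:
  assumes "finite F" shows "\<exists>N. F \<subseteq> (\<Union>m<N. P m)"
  using assms
proof (induction F)
  case (insert x F)
  then obtain N where "F \<subseteq> (\<Union>m<N. P m)" by auto
  moreover obtain m where "x \<in> P m" using blocks_cover by (metis UNIV_I UN_E)
  ultimately
  show ?case by (intro exI[of _ "max N (Suc m)"]) (force simp: less_max_iff_disj)
qed auto

lemma sum_blocks: "(\<Sum>i\<in>(\<Union>m<N. P m). f i) = (\<Sum>m<N. \<Sum>i\<in>P m. f i :: real)"
  by (rule sum.UNION_disjoint)
    (use finite_block disjoint_blocks in \<open>auto simp: disjoint_family_on_def\<close>)

text \<open>A finite index set meets finitely many blocks, so summable bounds per block control all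
  finite partial sums at once. Membership in \<open>l2space\<close> and bounds on
  \<open>l2dist\<close> both come from this.\<close>

lemma finite_sum_le_block_suminf:
  fixes z :: "'i \<Rightarrow> real"
  assumes "\<And>m. (\<Sum>i\<in>P m. (z i)\<^sup>2) \<le> c m" "summable c" "finite F"
  shows "(\<Sum>i\<in>F. (z i)\<^sup>2) \<le> suminf c"
proof -
  have c0: "0 \<le> c m" for m using assms(1)[of m] sum_nonneg[of "P m" "\<lambda>i. (z i)\<^sup>2"] by force
  obtain N where N: "F \<subseteq> (\<Union>m<N. P m)" using finite_subset_blocks[OF assms(3)] by auto
  have "(\<Sum>i\<in>F. (z i)\<^sup>2) \<le> (\<Sum>i\<in>(\<Union>m<N. P m). (z i)\<^sup>2)"
    by (rule sum_mono2) (use N finite_block in auto)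
  also have "\<dots> \<le> (\<Sum>m<N. c m)" unfolding sum_blocks by (intro sum_mono assms(1))
  also have "\<dots> \<le> suminf c" by (rule sum_le_suminf) (use assms c0 in auto)
  finally show ?thesis .
qed

lemma l2space_blocks:
  assumes "\<And>m. (\<Sum>i\<in>P m. (z i)\<^sup>2) \<le> c m" "summable c"
  shows "z \<in> l2space"
  unfolding l2space_def
  using finite_sum_le_block_suminf[OF assms]
  by (auto intro!: nonneg_bdd_above_summable_on bdd_aboveI)

lemma l2dist_blocks:
  assumes "x \<in> l2space" "y \<in> l2space" "\<And>m. (\<Sum>i\<in>P m. (x i - y i)\<^sup>2) \<le> c m" "summable c"
    and "suminf c \<le> r\<^sup>2" "0 \<le> r"
  shows "l2dist x y \<le> r"
  by (rule l2dist_le)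
    (use assms finite_sum_le_block_suminf[of "\<lambda>i. x i - y i" c] in \<open>auto intro: order_trans\<close>)

lemma sum_block_le_l2dist:
  assumes "x \<in> l2space" "y \<in> l2space"
  shows "(\<Sum>i\<in>P m. (x i - y i)\<^sup>2) \<le> (l2dist x y)\<^sup>2"
proof -
  have "(L2_set (\<lambda>i. x i - y i) (P m))\<^sup>2 \<le> (l2dist x y)\<^sup>2"
    using L2_set_le_l2dist[OF assms finite_block] by (intro power_mono) auto
  then show ?thesis by (simp add: L2_set_def sum_nonneg)
qed

text \<open>The majorant \<open>c\<close> makes the tails of all sequences in \<open>K\<close>
  uniformly small, so closeness on finitely many blocks forces closeness in l2. This transfers both
  compactness and Borel measurability from the product topology.\<close>

lemma continuous_map_product_to_l2:
  assumes c: "summable c" and K: "\<And>x m. x \<in> K \<Longrightarrow> (\<Sum>i\<in>P m. (x i)\<^sup>2) \<le> c m"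
  shows "continuous_map (top_of_set K) l2top (\<lambda>x. x)"
  unfolding l2top_def l2.continuous_map_to_metric
proof (intro ballI allI impI)
  fix x and e :: real assume x: "x \<in> topspace (top_of_set K)" and e: "e > 0"
  have K2: "K \<subseteq> l2space" using l2space_blocks[OF K c] by auto
  have c0: "0 \<le> c m" for m using K[of x m] sum_nonneg[of "P m" "\<lambda>i. (x i)\<^sup>2"] x by force
  have "(\<lambda>n. suminf (\<lambda>m. c (m + n))) \<longlonglongrightarrow> 0" using suminf_exist_split2[OF c] .
  \<comment> \<open>The tail of the difference is at most four times the tail of \<open>c\<close>,
    hence below \<open>e\<^sup>2 / 4\<close>; the first blocks, measured by \<open>g y\<close>, take
    another quarter.\<close>
  then have "\<forall>\<^sub>F n in sequentially. suminf (\<lambda>m. c (m + n)) < e\<^sup>2 / 16"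
    using e by (intro order_tendstoD(2)[where y = 0]) auto
  then obtain N where N: "suminf (\<lambda>m. c (m + N)) < e\<^sup>2 / 16"
    by (auto simp: eventually_sequentially)
  define g where "g y = (\<Sum>m<N. \<Sum>i\<in>P m. (y i - x i)\<^sup>2)" for y
  have g: "continuous_on UNIV g" unfolding g_def by (intro continuous_intros) auto
  define U where "U = K \<inter> {y. g y < e\<^sup>2 / 4}"
  have "open {y. g y < e\<^sup>2 / 4}" using g by (intro open_Collect_less) auto
  then have "openin (top_of_set K) U" unfolding U_def by auto
  moreover have "x \<in> U" using x e by (auto simp: U_def g_def)
  moreover have "y \<in> l2.mball x e" if "y \<in> U" for y
  proof -
    have yK: "y \<in> K" and gy: "g y < e\<^sup>2 / 4" using that by (auto simp: U_def)
    define b where "b m = (if m < N then (\<Sum>i\<in>P m. (y i - x i)\<^sup>2) else 0)" for m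
    define b' where "b' m = (if m < N then 0 else 4 * c m)" for m
    have "b sums (\<Sum>m<N. \<Sum>i\<in>P m. (y i - x i)\<^sup>2)"
      using sums_If_finite_set[of "{..<N}"  "\<lambda>m. \<Sum>i\<in>P m. (y i - x i)\<^sup>2"]
      by (simp add: b_def[abs_def])
    then have b: "b sums g y" by (simp add: g_def)
    have "(\<lambda>m. b' (m + N)) sums (4 * suminf (\<lambda>m. c (m + N)))"
      unfolding b'_def using summable_ignore_initial_segment[OF c, of N]
      by (auto intro!: sums_mult summable_sums)
    then have b': "b' sums (4 * suminf (\<lambda>m. c (m + N)))"
      by (subst (asm) sums_iff_shift) (simp add: b'_def)
    have "l2dist x y \<le> sqrt (g y + 4 * suminf (\<lambda>m. c (m + N)))"
    proof (rule l2dist_blocks)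
      show "(\<Sum>i\<in>P m. (x i - y i)\<^sup>2) \<le> b m + b' m" for m
      proof (cases "m < N")
        case True then show ?thesis by (simp add: b_def b'_def power2_commute)
      next
        case False
        have "(\<Sum>i\<in>P m. (x i - y i)\<^sup>2) \<le> (\<Sum>i\<in>P m. 2 * (x i)\<^sup>2 + 2 * (y i)\<^sup>2)"
          by (intro sum_mono power2_diff_le)
        also have "\<dots> \<le> 4 * c m"
          using K[of x m] K[OF yK, of m] x by (simp add: sum.distrib flip: sum_distrib_left)
        finally show ?thesis using False by (simp add: b_def b'_def)
      qed
      show "summable (\<lambda>m. b m + b' m)" using sums_add[OF b b'] by (rule sums_summable)
      have nn: "0 \<le> g y + 4 * suminf (\<lambda>m. c (m + N))"
        using c0 c by (auto intro!: add_nonneg_nonneg suminf_nonneg sum_nonneg simp: g_def)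
      then show "(\<Sum>m. b m + b' m) \<le> (sqrt (g y + 4 * suminf (\<lambda>m. c (m + N))))\<^sup>2"
        using sums_unique[OF sums_add[OF b b']] by simp
      show "0 \<le> sqrt (g y + 4 * suminf (\<lambda>m. c (m + N)))" using nn by simp
    qed (use x yK K2 in auto)
    also have "\<dots> < sqrt (e\<^sup>2)" using gy N zero_less_power[OF e, of 2]
      by (intro real_sqrt_less_mono) linarith
    finally show ?thesis using e x yK K2 by (auto simp: l2.in_mball)
  qed
  ultimately show "\<exists>U. openin (top_of_set K) U \<and> x \<in> U \<and> (\<forall>y\<in>U. y \<in> l2.mball x e)" by blast
qed

end

section \<open>Compactness of the unit ball\<close>

definition scaled_norm :: "ennreal \<Rightarrow> real \<Rightarrow> (nat \<Rightarrow> 'i set) \<Rightarrow> ('i \<Rightarrow> real) \<Rightarrow> nat \<Rightarrow> real" where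
  "scaled_norm p \<alpha> P x m = 2 powr (\<alpha> * real m) * lp_norm_fin p (P m) x"

text \<open>For positive \<open>p\<close> and \<open>C\<close> this is the ball of radius
  \<open>C\<close> in the mixed space with weight \<beta>, inner exponent \<open>p\<close> and outer
  exponent infinity. The exponent is real here, and \<open>p\<close>-th powers avoid roots.\<close>

definition block_ball :: "(nat \<Rightarrow> 'i set) \<Rightarrow> real \<Rightarrow> real \<Rightarrow> real \<Rightarrow> ('i \<Rightarrow> real) set" where
  "block_ball P p C \<beta> =
     {x. \<forall>m. (\<Sum>i\<in>P m. \<bar>x i\<bar> powr p) \<le> (C * 2 powr (- \<beta> * real m)) powr p}"

lemma enn2real_exponent_pos: "0 < p \<Longrightarrow> p \<noteq> \<infinity> \<Longrightarrow> 0 < enn2real p"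
  by (simp add: enn2real_positive_iff top.not_eq_extremum)

lemma powr_le_powr_iff:
  fixes r s e :: real assumes "0 \<le> r" "0 \<le> s" "0 < e" shows "r powr e \<le> s powr e \<longleftrightarrow> r \<le> s"
  using assms powr_mono2[of e r s] powr_less_mono2[of e s r] by fastforce

lemma powr_le_one_iff:
  fixes r e :: real assumes "0 \<le> r" "0 < e" shows "r powr e \<le> 1 \<longleftrightarrow> r \<le> 1"
  using powr_le_powr_iff[of r 1 e] assms by simp

lemma lp_norm_fin_nonneg: "finite B \<Longrightarrow> 0 \<le> lp_norm_fin p B x"
  by (auto simp: lp_norm_fin_def Max_ge_iff intro: order_trans[OF abs_ge_zero])

text \<open>Each condition on the right involves finitely many coordinates, which exhibits the ball
  as an intersection of closed sets in the product topology.\<close>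

lemma mixed_unit_ball_iff:
  assumes q: "q > 0" and P: "\<And>m. finite (P m)"
  shows "x \<in> mixed_unit_ball p q \<alpha> P \<longleftrightarrow>
    (if q = \<infinity> then \<forall>m. scaled_norm p \<alpha> P x m \<le> 1
     else \<forall>N. (\<Sum>m<N. scaled_norm p \<alpha> P x m powr enn2real q) \<le> 1)"
proof (cases "q = \<infinity>")
  case True
  then show ?thesis
    by (simp add: mixed_unit_ball_def mixed_norm_def scaled_norm_def[abs_def] SUP_le_iff)
next
  case False
  define s where "s = (\<Sum>m. ennreal (scaled_norm p \<alpha> P x m powr enn2real q))"
  have "mixed_norm p q \<alpha> P x = (if s = \<infinity> then \<infinity> else ennreal (enn2real s powr (1 / enn2real q)))"
    using False by (simp add: mixed_norm_def scaled_norm_def s_def)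
  also have "\<dots> \<le> 1 \<longleftrightarrow> s \<le> 1"
  proof (cases s)
    case (real r)
    then show ?thesis using powr_le_one_iff[of r "1 / enn2real q"] enn2real_exponent_pos[OF q False] by simp
  qed (simp add: top_unique)
  also have "s \<le> 1 \<longleftrightarrow> (\<forall>N. (\<Sum>m<N. scaled_norm p \<alpha> P x m powr enn2real q) \<le> 1)"
    by (simp add: s_def suminf_eq_SUP SUP_le_iff sum_ennreal)
  finally show ?thesis using False by (simp add: mixed_unit_ball_def)
qed

text \<open>The factor |x|^(2-p) of the square grows with |x| because \<open>p \<le> 2\<close>. With
  \<open>t\<close> a bound for the block norm this yields the embedding into l2; with
  \<open>t\<close> a threshold it bounds the energy of the discarded entries.\<close>

lemma sum_squares_le_powr:
  fixes x :: "'i \<Rightarrow> real" and p t :: real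
  assumes p: "0 < p" "p \<le> 2" and t: "\<And>i. i \<in> B \<Longrightarrow> \<bar>x i\<bar> \<le> t"
  shows "(\<Sum>i\<in>B. (x i)\<^sup>2) \<le> t powr (2 - p) * (\<Sum>i\<in>B. \<bar>x i\<bar> powr p)"
  unfolding sum_distrib_left
proof (rule sum_mono)
  fix i assume i: "i \<in> B"
  show "(x i)\<^sup>2 \<le> t powr (2 - p) * \<bar>x i\<bar> powr p"
  proof (cases "x i = 0")
    case False
    have "(x i)\<^sup>2 = \<bar>x i\<bar> powr (2 - p) * \<bar>x i\<bar> powr p"
      using False by (simp flip: powr_add)
    also have "\<dots> \<le> t powr (2 - p) * \<bar>x i\<bar> powr p"
      using p t[OF i] by (intro mult_right_mono powr_mono2) auto
    finally show ?thesis .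
  qed simp
qed

lemma abs_le_of_sum_powr_le:
  assumes "finite B" "i \<in> B" "0 < p" "0 \<le> c" "(\<Sum>i\<in>B. \<bar>x i\<bar> powr p) \<le> c powr p"
  shows "\<bar>x i :: real\<bar> \<le> c"
proof -
  have "\<bar>x i\<bar> powr p \<le> (\<Sum>i\<in>B. \<bar>x i\<bar> powr p)"
    using assms by (intro member_le_sum) auto
  then have "\<bar>x i\<bar> powr p \<le> c powr p" using assms by linarith
  then show ?thesis using assms by (simp add: powr_le_powr_iff)
qed

lemma sum_squares_le_of_sum_powr_le:
  assumes "finite B" "0 < p" "p \<le> 2" "0 < c" "(\<Sum>i\<in>B. \<bar>x i :: real\<bar> powr p) \<le> c powr p"
  shows "(\<Sum>i\<in>B. (x i)\<^sup>2) \<le> c\<^sup>2"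
proof -
  have "(\<Sum>i\<in>B. (x i)\<^sup>2) \<le> c powr (2 - p) * (\<Sum>i\<in>B. \<bar>x i\<bar> powr p)"
    using assms abs_le_of_sum_powr_le[of B _ p c x] by (intro sum_squares_le_powr) auto
  also have "\<dots> \<le> c powr (2 - p) * c powr p" using assms by (intro mult_left_mono) auto
  also have "\<dots> = c\<^sup>2" using assms by (simp flip: powr_add)
  finally show ?thesis .
qed

lemma summable_two_powr: "0 < (\<beta>::real) \<Longrightarrow> summable (\<lambda>m. 2 powr (- \<beta> * real m))"
proof -
  assume "0 < \<beta>"
  then have "(2::real) powr (- \<beta>) < 2 powr 0" by (intro powr_less_mono) auto
  then have "summable (\<lambda>m. (2 powr (- \<beta>)) ^ m)" by (intro summable_geometric) simp
  moreover have "(2 powr (- \<beta>)) ^ m = 2 powr (- \<beta> * real m)" for m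
    by (simp add: powr_power mult.commute)
  ultimately show ?thesis by simp
qed

lemma continuous_on_lp_norm_fin:
  fixes B :: "'i set"
  assumes "p > 0" "finite B" shows "continuous_on UNIV (lp_norm_fin p B)"
proof (cases "p = \<infinity>")
  case True
  have "continuous_on UNIV (\<lambda>x. Max ((\<lambda>i. \<bar>x i :: real\<bar>) ` B))" if "B \<noteq> {}"
    using assms(2) that
  proof (induction B rule: finite_ne_induct)
    case (insert i F)
    have "Max ((\<lambda>i. \<bar>x i\<bar>) ` insert i F) = max \<bar>x i\<bar> (Max ((\<lambda>i. \<bar>x i\<bar>) ` F))" for x :: "'i \<Rightarrow> real"
      using insert by simp
    then show ?case using insert by (auto intro!: continuous_intros)
  qed (auto intro!: continuous_intros)
  then show ?thesis using True by (cases "B = {}") (auto simp: lp_norm_fin_def[abs_def])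
next
  case False
  then show ?thesis using enn2real_exponent_pos[OF assms(1) False]
    by (auto simp: lp_norm_fin_def[abs_def] intro!: continuous_intros continuous_on_powr' sum_nonneg)
qed

section \<open>Closedness and compactness in the product topology\<close>

context finite_blocks
begin

lemma block_ball_sum_squares:
  assumes "x \<in> block_ball P p C \<beta>" "0 < p" "p \<le> 2" "0 < C"
  shows "(\<Sum>i\<in>P m. (x i)\<^sup>2) \<le> (C * 2 powr (- \<beta> * real m))\<^sup>2"
  using assms finite_block by (intro sum_squares_le_of_sum_powr_le[where p = p]) (auto simp: block_ball_def)

lemma summable_block_ball_bound:
  assumes "0 < \<beta>" shows "summable (\<lambda>m. (C * 2 powr (- \<beta> * real m))\<^sup>2)"
proof -
  have "(C * 2 powr (- \<beta> * real m))\<^sup>2 = C\<^sup>2 * 2 powr (- (2 * \<beta>) * real m)" for m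
    by (simp add: power_mult_distrib powr_power algebra_simps)
  then show ?thesis using summable_two_powr[of "2 * \<beta>"] assms by (auto intro: summable_mult)
qed

lemma block_ball_subset_l2space:
  assumes "0 < p" "p \<le> 2" "0 < C" "0 < \<beta>"
  shows "block_ball P p C \<beta> \<subseteq> l2space"
  using l2space_blocks[OF _ summable_block_ball_bound] block_ball_sum_squares assms by (metis subsetI)

lemma block_ball_abs_le:
  assumes "x \<in> block_ball P p C \<beta>" "0 < p" "0 < C" "0 < \<beta>"
  shows "\<bar>x i\<bar> \<le> C"
proof -
  obtain m where m: "i \<in> P m" using blocks_cover by (metis UNIV_I UN_E)
  have "\<bar>x i\<bar> \<le> C * 2 powr (- \<beta> * real m)"
    using assms m finite_block
    by (intro abs_le_of_sum_powr_le[where p = p and B = "P m"]) (auto simp: block_ball_def)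
  also have "\<dots> \<le> C * 2 powr 0" using assms by (intro mult_left_mono powr_mono) auto
  finally show ?thesis by simp
qed

lemma closed_mixed_unit_ball:
  assumes p: "p > 0" and q: "q > 0"
  shows "closed (mixed_unit_ball p q \<alpha> P)"
proof -
  have cn: "continuous_on UNIV (\<lambda>x. scaled_norm p \<alpha> P x m)" for m
    unfolding scaled_norm_def using continuous_on_lp_norm_fin[OF p finite_block]
    by (intro continuous_intros)
  show ?thesis
  proof (cases "q = \<infinity>")
    case True
    then have "mixed_unit_ball p q \<alpha> P = (\<Inter>m. {x. scaled_norm p \<alpha> P x m \<le> 1})"
      using mixed_unit_ball_iff[OF q finite_block] by auto
    then show ?thesis using cn by (auto intro!: closed_INT closed_Collect_le)
  next
    case False
    then have "mixed_unit_ball p q \<alpha> P =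
        (\<Inter>N. {x. (\<Sum>m<N. scaled_norm p \<alpha> P x m powr enn2real q) \<le> 1})"
      using mixed_unit_ball_iff[OF q finite_block] by auto
    moreover have "continuous_on UNIV (\<lambda>x. \<Sum>m<N. scaled_norm p \<alpha> P x m powr enn2real q)" for N
      using cn enn2real_exponent_pos[OF q False] lp_norm_fin_nonneg[OF finite_block]
      by (intro continuous_on_sum continuous_on_powr') (auto simp: scaled_norm_def)
    ultimately show ?thesis by (auto intro!: closed_INT closed_Collect_le)
  qed
qed

text \<open>By \<open>block_ball_abs_le\<close> all entries lie between \<open>- C\<close> and
  \<open>C\<close>, so \<open>S\<close> is a closed subset of a compact cube; the identity into
  \<open>l2top\<close> is continuous on \<open>S\<close> and preserves compactness.\<close>

lemma compactin_l2top:
  assumes S: "closed S" and sub: "S \<subseteq> block_ball P p C \<beta>"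
    and "0 < p" "p \<le> 2" "0 < C" "0 < \<beta>"
  shows "compactin l2top S"
proof -
  define B where "B i = {- C .. C}" for i :: 'i
  have "x i \<in> B i" if "x \<in> S" for x i
    using block_ball_abs_le[of x p C \<beta> i] that sub assms by (auto simp: B_def abs_le_iff)
  then have SB: "S \<subseteq> PiE UNIV B" by auto
  have "compactin (product_topology (\<lambda>i. euclidean) UNIV) (PiE UNIV B)"
    by (auto simp: compactin_PiE B_def)
  then have "compact (PiE UNIV B)" by (simp add: euclidean_product_topology)
  then have "compact S" using SB S by (metis compact_Int_closed inf.absorb_iff2)
  then have "compactin (top_of_set S) S" by (simp add: compactin_subtopology)
  moreover have "continuous_map (top_of_set S) l2top (\<lambda>x. x)"
    by (rule continuous_map_product_to_l2[OF summable_block_ball_bound])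
      (use assms block_ball_sum_squares in blast)+
  ultimately show ?thesis using image_compactin[of "top_of_set S" S l2top "\<lambda>x. x"] by simp
qed

end

section \<open>Regular partitions and the reduction to exponents at most two\<close>

locale regular_blocks = finite_blocks P for P :: "nat \<Rightarrow> 'i set" +
  fixes d :: nat and a :: real and A :: nat
  assumes d_pos: "d \<ge> 1" and a_pos: "a > 0"
    and card_ge: "a * 2 ^ (d * m) \<le> real (card (P m))"
    and card_le: "card (P m) \<le> A * 2 ^ (d * m)"
begin

lemma card_block_pos: "0 < card (P m)"
  using card_ge[of m] a_pos by (metis gr0I less_le_trans mult_pos_pos of_nat_0 order_less_irrefl zero_less_numeral zero_less_power)

lemma A_pos: "A \<ge> 1"
  using card_le[of 0] card_block_pos[of 0] by simp

lemma two_power_dm: "(2::real) ^ (d * m) = 2 powr (real d * real m)"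
  by (metis of_nat_mult powr_realpow zero_less_numeral)

lemma card_block_le_real: "real (card (P m)) \<le> real A * 2 powr (real d * real m)"
  using card_le[of m] unfolding two_power_dm[symmetric]
  by (metis of_nat_le_iff of_nat_mult of_nat_numeral of_nat_power)

text \<open>For \<open>p > 2\<close> the bound comes from \<open>x\<^sup>2 \<le> t\<^sup>2 + t\<^sup>2\<^sup>-\<^sup>p |x|\<^sup>p\<close> with \<open>t\<close> the size of the entries
  of a constant block, which replaces Hoelder's inequality at the cost of a factor 2.\<close>
lemma sum_squares_le_lp_norm:
  assumes p: "p > 0" "inv_exp p < 1/2"
    and x: "lp_norm_fin p (P m) x \<le> 2 powr (- \<alpha> * real m)"
  shows "(\<Sum>i\<in>P m. (x i)\<^sup>2) \<le> 2 * A * (2 powr (- (\<alpha> - real d * (1/2 - inv_exp p)) * real m))\<^sup>2"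
proof -
  define n where "n = real (card (P m))"
  define c where "c = (2::real) powr (- \<alpha> * real m)"
  have n: "n > 0" using card_block_pos by (simp add: n_def)
  have c: "c > 0" by (simp add: c_def)
  define t where "t = c * n powr (- inv_exp p)"
  have t: "t > 0" using n c by (simp add: t_def)
  have ne: "P m \<noteq> {}" using card_block_pos[of m] by auto
  have "(\<Sum>i\<in>P m. (x i)\<^sup>2) \<le> 2 * n * t\<^sup>2"
  proof (cases "p = \<infinity>")
    case True
    have "(x i)\<^sup>2 \<le> t\<^sup>2" if "i \<in> P m" for i
    proof -
      have "\<bar>x i\<bar> \<le> t" using x that True ne finite_block n
        by (auto simp: lp_norm_fin_def c_def t_def inv_exp_def)
      then show ?thesis using t by (simp add: abs_le_square_iff[symmetric])
    qed
    then have "(\<Sum>i\<in>P m. (x i)\<^sup>2) \<le> (\<Sum>i\<in>P m. t\<^sup>2)" by (intro sum_mono)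
    also have "\<dots> \<le> 2 * n * t\<^sup>2" by (simp add: n_def)
    finally show ?thesis .
  next
    case False
    define r where "r = enn2real p"
    have r0: "r > 0" using enn2real_exponent_pos[OF p(1) False] by (simp add: r_def)
    have ie: "inv_exp p = 1 / r" using False by (simp add: inv_exp_def r_def)
    have r: "r > 2" using p(2) r0 by (simp add: ie field_simps)
    have "(\<Sum>i\<in>P m. \<bar>x i\<bar> powr r) powr (1 / r) \<le> c"
      using x False by (simp add: lp_norm_fin_def r_def c_def)
    then have "((\<Sum>i\<in>P m. \<bar>x i\<bar> powr r) powr (1 / r)) powr r \<le> c powr r"
      using r0 by (intro powr_mono2) auto
    then have s: "(\<Sum>i\<in>P m. \<bar>x i\<bar> powr r) \<le> c powr r"
      using r0 by (simp add: powr_powr sum_nonneg)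
    have "(x i)\<^sup>2 \<le> t\<^sup>2 + t powr (2 - r) * \<bar>x i\<bar> powr r" for i
    proof (cases "\<bar>x i\<bar> \<le> t")
      case True
      then have "(x i)\<^sup>2 \<le> t\<^sup>2" using t by (simp add: abs_le_square_iff[symmetric])
      then show ?thesis by (smt (verit) mult_nonneg_nonneg powr_ge_zero)
    next
      case False
      then have "(x i)\<^sup>2 = \<bar>x i\<bar> powr (2 - r) * \<bar>x i\<bar> powr r"
        using t by (simp flip: powr_add)
      also have "\<dots> \<le> t powr (2 - r) * \<bar>x i\<bar> powr r"
        using r False t by (intro mult_right_mono powr_mono2') auto
      finally show ?thesis by (smt (verit) zero_le_power2)
    qed
    then have "(\<Sum>i\<in>P m. (x i)\<^sup>2) \<le> (\<Sum>i\<in>P m. t\<^sup>2 + t powr (2 - r) * \<bar>x i\<bar> powr r)"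
      by (intro sum_mono)
    also have "\<dots> = n * t\<^sup>2 + t powr (2 - r) * (\<Sum>i\<in>P m. \<bar>x i\<bar> powr r)"
      by (simp add: sum.distrib n_def sum_distrib_left)
    also have "\<dots> \<le> n * t\<^sup>2 + t powr (2 - r) * c powr r"
      by (intro add_left_mono mult_left_mono s) auto
    also have "c powr r = t powr r * n"
    proof -
      have "t powr r = c powr r * n powr (- inv_exp p * r)"
        using n c by (simp add: t_def powr_mult powr_powr)
      also have "- inv_exp p * r = - 1" using r0 by (simp add: ie)
      finally show ?thesis using n by (simp add: powr_minus_divide)
    qed
    also have "t powr (2 - r) * (t powr r * n) = t\<^sup>2 * n"
      using t by (simp add: mult.assoc[symmetric] flip: powr_add)
    finally show ?thesis by simp
  qed
  also have "\<dots> = 2 * c\<^sup>2 * n powr (1 - 2 * inv_exp p)"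
    using n by (simp add: t_def power_mult_distrib powr_power powr_diff powr_minus field_simps)
  also have "\<dots> \<le> 2 * c\<^sup>2 * (A * 2 powr (real d * real m * (1 - 2 * inv_exp p)))"
  proof (intro mult_left_mono)
    have ip: "inv_exp p \<ge> 0" by (simp add: inv_exp_def)
    have nA: "n \<le> A * 2 powr (real d * real m)"
      unfolding n_def by (rule card_block_le_real)
    have "n powr (1 - 2 * inv_exp p) \<le> (A * 2 powr (real d * real m)) powr (1 - 2 * inv_exp p)"
      using p n nA by (intro powr_mono2) auto
    also have "\<dots> = A powr (1 - 2 * inv_exp p) * 2 powr (real d * real m * (1 - 2 * inv_exp p))"
      by (simp add: powr_mult powr_powr)
    also have "\<dots> \<le> A powr 1 * 2 powr (real d * real m * (1 - 2 * inv_exp p))"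
      using A_pos ip by (intro mult_right_mono powr_mono) auto
    finally show "n powr (1 - 2 * inv_exp p) \<le> A * 2 powr (real d * real m * (1 - 2 * inv_exp p))"
      using A_pos by simp
  qed auto
  also have "\<dots> = 2 * A * (2 powr (- (\<alpha> - real d * (1/2 - inv_exp p)) * real m))\<^sup>2"
    by (simp add: c_def powr_power flip: powr_add) (simp add: algebra_simps)
  finally show ?thesis .
qed

lemma mixed_unit_ball_lp_norm_le:
  assumes q: "q > 0" and x: "x \<in> mixed_unit_ball p q \<alpha> P"
  shows "lp_norm_fin p (P m) x \<le> 2 powr (- \<alpha> * real m)"
proof -
  have nn: "0 \<le> scaled_norm p \<alpha> P x m" for m
    by (simp add: scaled_norm_def lp_norm_fin_nonneg finite_block)
  have "scaled_norm p \<alpha> P x m \<le> 1"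
  proof (cases "q = \<infinity>")
    case False
    have "scaled_norm p \<alpha> P x m powr enn2real q \<le> (\<Sum>m<Suc m. scaled_norm p \<alpha> P x m powr enn2real q)"
      by (rule member_le_sum) auto
    also have "\<dots> \<le> 1" using iffD1[OF mixed_unit_ball_iff[OF q finite_block] x] False
      by (simp del: sum.lessThan_Suc)
    finally show ?thesis using powr_le_one_iff[OF nn enn2real_exponent_pos[OF q False]] by simp
  qed (use iffD1[OF mixed_unit_ball_iff[OF q finite_block] x] in simp)
  then show ?thesis by (simp add: scaled_norm_def powr_minus field_simps)
qed

text \<open>For \<open>p > 2\<close> the choice is \<open>r = 2\<close>, with \<beta> equal to
  \<alpha> lowered by \<open>d * (1/2 - inv_exp p)\<close> and positive by the hypothesis on
  \<alpha>; otherwise \<open>r = p\<close> and \<beta> = \<alpha>. The exponent governing the rate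
  is preserved, so codecs for the larger set suffice. \<open>C\<close> is a natural number because
  it later bounds integer grid values.\<close>

lemma mixed_unit_ball_subset_block_ball:
  assumes p: "p > 0" and q: "q > 0" and \<alpha>: "\<alpha> > real d * max 0 (1/2 - inv_exp p)"
  obtains r C \<beta> where "0 < r" "r \<le> 2" "1 \<le> C" "0 < \<beta>"
    "\<beta> / real d + 1 / r - 1 / 2 = \<alpha> / real d - (1/2 - inv_exp p)"
    "mixed_unit_ball p q \<alpha> P \<subseteq> block_ball P r (real C) \<beta>"
proof (cases "inv_exp p < 1/2")
  case True
  define \<beta> where "\<beta> = \<alpha> - real d * (1/2 - inv_exp p)"
  show ?thesis
  proof (rule that[of 2 "2 * A" \<beta>])
    show "0 < \<beta>" using \<alpha> True by (simp add: \<beta>_def)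
    show "\<beta> / real d + 1 / 2 - 1 / 2 = \<alpha> / real d - (1/2 - inv_exp p)"
      using d_pos by (simp add: \<beta>_def field_simps)
    show "mixed_unit_ball p q \<alpha> P \<subseteq> block_ball P 2 (real (2 * A)) \<beta>"
    proof
      fix x assume x: "x \<in> mixed_unit_ball p q \<alpha> P"
      have "(\<Sum>i\<in>P m. \<bar>x i\<bar> powr 2) \<le> (real (2 * A) * 2 powr (- \<beta> * real m)) powr 2" for m
      proof -
        have "(\<Sum>i\<in>P m. (x i)\<^sup>2) \<le> 2 * A * (2 powr (- \<beta> * real m))\<^sup>2"
          unfolding \<beta>_def by (rule sum_squares_le_lp_norm[OF p True mixed_unit_ball_lp_norm_le[OF q x]])
        \<comment> \<open>\<open>block_ball\<close> squares its constant; passing from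
          \<open>2 * A\<close> to its square is allowed since \<open>2 * A \<ge> 1\<close>.\<close>
        also have "\<dots> \<le> (2 * A)\<^sup>2 * (2 powr (- \<beta> * real m))\<^sup>2"
          using A_pos self_le_power[of "real (2 * A)" 2] by (intro mult_right_mono) auto
        finally show ?thesis by (simp add: power_mult_distrib)
      qed
      then show "x \<in> block_ball P 2 (real (2 * A)) \<beta>" by (simp add: block_ball_def)
    qed
  qed (use A_pos in auto)
next
  case False
  then have fin: "p \<noteq> \<infinity>" by (auto simp: inv_exp_def)
  define r where "r = enn2real p"
  have r0: "r > 0" using enn2real_exponent_pos[OF p fin] by (simp add: r_def)
  have ie: "inv_exp p = 1 / r" using fin by (simp add: inv_exp_def r_def)
  show ?thesis
  proof (rule that[of r 1 \<alpha>])
    show "r \<le> 2" using False r0 by (simp add: ie field_simps)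
    show "0 < \<alpha>" using \<alpha> False by simp
    show "mixed_unit_ball p q \<alpha> P \<subseteq> block_ball P r (real 1) \<alpha>"
    proof
      fix x assume x: "x \<in> mixed_unit_ball p q \<alpha> P"
      have "(\<Sum>i\<in>P m. \<bar>x i\<bar> powr r) \<le> (real 1 * 2 powr (- \<alpha> * real m)) powr r" for m
      proof -
        have "(\<Sum>i\<in>P m. \<bar>x i\<bar> powr r) powr (1 / r) \<le> 2 powr (- \<alpha> * real m)"
          using mixed_unit_ball_lp_norm_le[OF q x, of m] fin by (simp add: lp_norm_fin_def r_def)
        then have "((\<Sum>i\<in>P m. \<bar>x i\<bar> powr r) powr (1 / r)) powr r \<le> (2 powr (- \<alpha> * real m)) powr r"
          using r0 by (intro powr_mono2) auto
        then show ?thesis using r0 by (simp add: powr_powr sum_nonneg)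
      qed
      then show "x \<in> block_ball P r (real 1) \<alpha>" by (simp add: block_ball_def)
    qed
  qed (use r0 ie in auto)
qed

end

section \<open>Codecs from sparse approximation\<close>

lemma codec_achieves_mono:
  assumes "S \<subseteq> T" "codec_achieves T s" shows "codec_achieves S s"
  using assms(2) unfolding codec_achieves_def
proof (elim exE, goal_cases)
  case (1 E D C)
  then show ?case using assms(1) by (intro exI[of _ E] exI[of _ D] exI[of _ C]) blast
qed

text \<open>The points of a net with at most \<open>2 ^ R\<close> elements are labelled injectively
  by bit strings of length \<open>R\<close>. The encoder sends the label of a near point, and the
  decoder inverts the labelling.\<close>

lemma codec_achieves_of_nets_for_bits:
  fixes S :: "('i \<Rightarrow> real) set"
  assumes "\<And>R. R \<ge> 1 \<Longrightarrow> \<exists>N. finite N \<and> N \<subseteq> l2space \<and> card N \<le> 2 ^ R \<and>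
    (\<forall>x\<in>S. \<exists>y\<in>N. real R powr s * l2dist x y \<le> C)"
  shows "codec_achieves S s"
proof -
  define good where "good R N \<longleftrightarrow> finite N \<and> N \<subseteq> l2space \<and> card N \<le> 2 ^ R \<and>
    (\<forall>x\<in>S. \<exists>y\<in>N. real R powr s * l2dist x y \<le> C)" for R N
  define N where "N R = (SOME N. good R N)" for R
  have "good R (N R)" if "R \<ge> 1" for R
    unfolding N_def by (rule someI_ex) (use assms[OF that] in \<open>simp add: good_def\<close>)
  then have N: "finite (N R) \<and> N R \<subseteq> l2space \<and> card (N R) \<le> 2 ^ R \<and>
    (\<forall>x\<in>S. \<exists>y\<in>N R. real R powr s * l2dist x y \<le> C)" if "R \<ge> 1" for R
    using that by (simp add: good_def)
  have "\<exists>f. f ` N R \<subseteq> {bs :: bool list. length bs = R} \<and> inj_on f (N R)" if "R \<ge> 1" for R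
  proof (rule card_le_inj)
    have "card {bs :: bool list. length bs = R} = 2 ^ R"
      using card_lists_length_eq[of "UNIV :: bool set" R] by simp
    then show "card (N R) \<le> card {bs :: bool list. length bs = R}" using N[OF that] by simp
    show "finite {bs :: bool list. length bs = R}"
      using finite_lists_length_eq[of "UNIV :: bool set" R] by simp
  qed (use N[OF that] in auto)
  then obtain f where f: "\<And>R. R \<ge> 1 \<Longrightarrow> f R ` N R \<subseteq> {bs :: bool list. length bs = R} \<and> inj_on (f R) (N R)"
    by metis
  define g where "g R x = (SOME y. y \<in> N R \<and> real R powr s * l2dist x y \<le> C)" for R x
  have g: "g R x \<in> N R \<and> real R powr s * l2dist x (g R x) \<le> C" if "R \<ge> 1" "x \<in> S" for R x
  proof -
    have "\<exists>y. y \<in> N R \<and> real R powr s * l2dist x y \<le> C" using N[OF that(1)] that(2) by blast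
    then show ?thesis unfolding g_def by (rule someI_ex)
  qed
  \<comment> \<open>For \<open>R = 0\<close> the length condition forces the empty string; strings
    that label no net point decode to the zero sequence, because \<open>D\<close> has to land in
    \<open>l2space\<close>.\<close>
  define E where "E R x = (if R \<ge> 1 then f R (g R x) else [])" for R :: nat and x
  define D where "D R bs = (if R \<ge> 1 \<and> bs \<in> f R ` N R then inv_into (N R) (f R) bs else (\<lambda>_. 0))" for R :: nat and bs
  have "length (E R x) = R" if "x \<in> S" for R x
  proof (cases "R \<ge> 1")
    case True
    then show ?thesis using f[OF True] g[OF True that] by (auto simp: E_def)
  qed (simp add: E_def)
  moreover have "D R bs \<in> l2space" for R bs
    using N[of R] inv_into_into[of bs "f R" "N R"] by (auto simp: D_def)
  moreover have "real R powr s * l2dist x (D R (E R x)) \<le> C" if "R \<ge> 1" "x \<in> S" for R x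
  proof -
    have "D R (E R x) = g R x" using f[OF that(1)] g[OF that] that by (simp add: D_def E_def)
    then show ?thesis using g[OF that] by simp
  qed
  ultimately show ?thesis unfolding codec_achieves_def
    by (intro exI[of _ E] exI[of _ D] exI[of _ C]) auto
qed

text \<open>Nets are given along the budgets \<open>L * b powr J\<close>. A bit count
  \<open>R\<close> in between uses the largest budget not exceeding it, at the cost of a constant
  factor \<open>b powr s\<close>.\<close>

lemma codec_achieves_of_geometric_nets:
  fixes S :: "('i \<Rightarrow> real) set" and b s L C0 C1 :: real
  assumes b: "b > 1" and s: "s > 0" and L: "L > 0"
    and bounded: "\<And>x. x \<in> S \<Longrightarrow> l2dist x (\<lambda>_. 0) \<le> C0"
    and net: "\<And>J::nat. \<exists>N. finite N \<and> N \<subseteq> l2space \<and> real (card N) \<le> 2 powr (L * b powr real J) \<and>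
      (\<forall>x\<in>S. \<exists>y\<in>N. l2dist x y \<le> C1 * b powr (- s * real J))"
  shows "codec_achieves S s"
proof (rule codec_achieves_of_nets_for_bits[where C = "max (L powr s * C0) ((L * b) powr s * C1)"])
  fix R :: nat assume R: "R \<ge> 1"
  show "\<exists>N. finite N \<and> N \<subseteq> l2space \<and> card N \<le> 2 ^ R \<and> (\<forall>x\<in>S. \<exists>y\<in>N. real R powr s * l2dist x y
      \<le> max (L powr s * C0) ((L * b) powr s * C1))"
  proof (cases "real R < L")
    \<comment> \<open>Below \<open>L\<close> bits no budget fits; the zero sequence is the
      reconstruction, and boundedness of \<open>S\<close> suffices.\<close>
    case True
    have "real R powr s * l2dist x (\<lambda>_. 0) \<le> L powr s * C0" if "x \<in> S" for x
      using True s bounded[OF that] by (intro mult_mono powr_mono2) (auto simp: l2dist_nonneg)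
    then show ?thesis by (intro exI[of _ "{\<lambda>_. 0}"]) (auto simp: le_max_iff_disj)
  next
    case False
    define u where "u = log b (real R / L)"
    have u0: "u \<ge> 0" using False L b by (simp add: u_def)
    define J where "J = nat \<lfloor>u\<rfloor>"
    have J: "real J \<le> u" "u < real J + 1" using u0 by (auto simp: J_def)
    have RL: "real R = L * b powr u" using L b R by (simp add: u_def)
    obtain N where N: "finite N" "N \<subseteq> l2space" "real (card N) \<le> 2 powr (L * b powr real J)"
      "\<And>x. x \<in> S \<Longrightarrow> \<exists>y\<in>N. l2dist x y \<le> C1 * b powr (- s * real J)" using net[of J] by blast
    have "L * b powr real J \<le> real R"
      unfolding RL using J b L by (intro mult_left_mono powr_mono) auto
    then have "real (card N) \<le> 2 powr real R" using N(3) by (meson order_trans powr_mono one_le_numeral)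
    then have "real (card N) \<le> real (2 ^ R)" by (simp add: powr_realpow)
    then have "card N \<le> 2 ^ R" by (simp only: of_nat_le_iff)
    moreover
    have "real R powr s * l2dist x y \<le> (L * b) powr s * C1"
      if y: "l2dist x y \<le> C1 * b powr (- s * real J)" for x y
    proof -
      have "real R \<le> L * b powr (real J + 1)"
        unfolding RL using J b L by (intro mult_left_mono powr_mono) auto
      then have "real R powr s \<le> (L * b powr (real J + 1)) powr s"
        using s by (intro powr_mono2) auto
      also have "\<dots> = (L * b) powr s * b powr (s * real J)"
      proof -
        have "L * b powr (real J + 1) = (L * b) * b powr real J" using b by (simp add: powr_add)
        then show ?thesis by (simp only: powr_mult powr_powr mult.commute[of s])
      qed
      finally have "real R powr s * l2dist x y
          \<le> ((L * b) powr s * b powr (s * real J)) * (C1 * b powr (- s * real J))"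
        using y by (intro mult_mono) (auto simp: l2dist_nonneg)
      also have "\<dots> = (L * b) powr s * C1 * (b powr (s * real J) * b powr (- s * real J))"
        by (simp only: mult_ac)
      also have "b powr (s * real J) * b powr (- s * real J) = 1"
        using b by (simp flip: powr_add)
      finally show ?thesis by simp
    qed
    then have "\<exists>y\<in>N. real R powr s * l2dist x y \<le> max (L powr s * C0) ((L * b) powr s * C1)"
      if "x \<in> S" for x using N(4)[OF that] by (meson le_max_iff_disj)
    ultimately show ?thesis using N by (intro exI[of _ N]) simp
  qed
qed

text \<open>This absorbs polynomial factors into an arbitrarily slow exponential, in the bit count
  of the codec and in the weights of the random signs. The proof squares a consequence of
  \<open>1 + t \<le> exp t\<close>, hence the half of \<delta>.\<close>

lemma square_le_exponential:
  assumes "(\<delta>::real) > 0"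
  obtains M where "M > 0" "\<forall>n::nat. (real n + 1)\<^sup>2 \<le> M * 2 powr (\<delta> * real n)"
proof -
  define \<mu> where "\<mu> = min 1 (\<delta> / 2 * ln 2)"
  have \<mu>: "\<mu> > 0" using assms by (simp add: \<mu>_def)
  have "(real n + 1)\<^sup>2 \<le> (1 / \<mu>)\<^sup>2 * 2 powr (\<delta> * real n)" for n :: nat
  proof -
    have "\<mu> * (real n + 1) \<le> 1 + \<delta> / 2 * ln 2 * real n"
    proof -
      have "\<mu> * real n \<le> \<delta> / 2 * ln 2 * real n" by (intro mult_right_mono) (auto simp: \<mu>_def)
      moreover have "\<mu> \<le> 1" by (simp add: \<mu>_def)
      ultimately show ?thesis by (simp add: distrib_left)
    qed
    also have "\<dots> \<le> exp (\<delta> / 2 * ln 2 * real n)" by (rule exp_ge_add_one_self)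
    also have "\<dots> = 2 powr (\<delta> / 2 * real n)" by (simp add: powr_def algebra_simps)
    finally have "(\<mu> * (real n + 1))\<^sup>2 \<le> (2 powr (\<delta> / 2 * real n))\<^sup>2"
      using \<mu> by (intro power_mono) auto
    also have "\<dots> = 2 powr (\<delta> * real n)" by (simp add: powr_power)
    finally have "\<mu>\<^sup>2 * (real n + 1)\<^sup>2 \<le> 2 powr (\<delta> * real n)" by (simp only: power_mult_distrib)
    then show ?thesis using \<mu> by (simp add: power_divide pos_le_divide_eq mult.commute)
  qed
  then show ?thesis using that[of "(1 / \<mu>)\<^sup>2"] \<mu> by simp
qed

section \<open>Sparse lists as reconstruction points\<close>

lemma l2space_finite_support:
  assumes "finite {i. z i \<noteq> 0}" shows "z \<in> l2space"
  unfolding l2space_def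
  using assms by (auto intro: finite_nonzero_values_imp_summable_on)

text \<open>A geometric tail is its first term times the full series, so one constant serves all
  starting points \<open>n\<close>.\<close>

lemma geometric_tail_sums:
  fixes \<gamma> w :: real assumes "\<gamma> > 0"
  shows "(\<lambda>m. if m < n then 0 else w * 2 powr (- \<gamma> * real m)) sums
    (w * 2 powr (- \<gamma> * real n) * (\<Sum>m. 2 powr (- \<gamma> * real m)))" (is "?f sums _")
proof -
  have "(\<lambda>m. (w * 2 powr (- \<gamma> * real n)) * 2 powr (- \<gamma> * real m)) sums
    (w * 2 powr (- \<gamma> * real n) * (\<Sum>m. 2 powr (- \<gamma> * real m)))"
    by (intro sums_mult summable_sums summable_two_powr assms)
  also have "(\<lambda>m. (w * 2 powr (- \<gamma> * real n)) * 2 powr (- \<gamma> * real m)) = (\<lambda>m. ?f (m + n))"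
  proof
    fix m
    have "- \<gamma> * real (m + n) = - \<gamma> * real n + - \<gamma> * real m" by (simp add: algebra_simps)
    then show "(w * 2 powr (- \<gamma> * real n)) * 2 powr (- \<gamma> * real m) = ?f (m + n)"
      by (simp only: powr_add) simp
  qed
  finally show ?thesis by (subst (asm) sums_iff_shift) simp
qed

text \<open>Padding with repetitions brings every set of kept positions to the same length
  \<open>k\<close>, so that the codebook consists of lists of fixed length and is easy to
  count.\<close>

lemma list_covering_set:
  assumes "finite W" "card W \<le> k" "W \<subseteq> F" "F \<noteq> {}"
  obtains ws where "length ws = k" "W \<subseteq> set ws" "set ws \<subseteq> F"
proof -
  obtain v where v: "set v = W" "distinct v" using finite_distinct_list[OF assms(1)] by auto
  obtain i where "i \<in> F" using assms by auto
  then show ?thesis using v assms distinct_card[OF v(2)]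
    by (intro that[of "v @ replicate (k - length v) i"]) auto
qed

text \<open>\<open>map_of\<close> reads the first entry for an index; repetitions caused by padding
  are harmless because the encoder attaches equal grid values to equal indices.\<close>

definition sparse_decode :: "real \<Rightarrow> ('i \<times> int) list \<Rightarrow> 'i \<Rightarrow> real" where
  "sparse_decode h xs i = (case map_of xs i of None \<Rightarrow> 0 | Some q \<Rightarrow> h * of_int q)"

lemma sparse_decode_in_l2space: "sparse_decode h xs \<in> l2space"
proof (rule l2space_finite_support)
  have "{i. sparse_decode h xs i \<noteq> 0} \<subseteq> fst ` set xs"
    by (force simp: sparse_decode_def split: option.splits dest: map_of_SomeD)
  then show "finite {i. sparse_decode h xs i \<noteq> 0}" by (rule finite_subset) simp
qed

lemma sparse_decode_map:
  "sparse_decode h (map (\<lambda>i. (i, f i)) ws) i = (if i \<in> set ws then h * of_int (f i) else 0)"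
  by (simp add: sparse_decode_def map_of_map_restrict)

section \<open>Thresholding and rounding in block balls\<close>

context regular_blocks
begin

text \<open>The budget for one block does not depend on the block: low blocks are kept entirely, and
  in a high block at most \<open>2\<^sup>d\<^sup>J\<close> entries exceed the threshold \<open>t m\<close>.\<close>
lemma block_ball_large_entries:
  fixes J n :: nat
  assumes x: "x \<in> block_ball P p C \<beta>" and p: "0 < p" and C: "0 < C"
  defines "t \<equiv> \<lambda>m. C * 2 powr (- \<beta> * real m) * 2 powr (- (real d * real J / p))"
  shows "card (\<Union>m<n. if m \<le> J then P m else {i \<in> P m. t m < \<bar>x i\<bar>}) \<le> n * (A * 2 ^ (d * J))"
proof -
  define W where "W m = (if m \<le> J then P m else {i \<in> P m. t m < \<bar>x i\<bar>})" for m
  have "card (W m) \<le> A * 2 ^ (d * J)" for m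
  proof (cases "m \<le> J")
    case True
    have "card (P m) \<le> A * 2 ^ (d * m)" by (rule card_le)
    also have "\<dots> \<le> A * 2 ^ (d * J)" using True by (intro mult_left_mono power_increasing) auto
    finally show ?thesis using True by (simp add: W_def)
  next
    case False
    define c where "c = C * 2 powr (- \<beta> * real m)"
    have c: "c > 0" using C by (simp add: c_def)
    have t: "t m powr p = c powr p / 2 powr (real d * real J)"
    proof -
      have "t m powr p = c powr p * 2 powr (- (real d * real J / p) * p)"
        by (simp add: t_def c_def powr_mult powr_powr)
      also have "- (real d * real J / p) * p = - (real d * real J)" using p by simp
      finally show ?thesis by (simp add: powr_minus_divide)
    qed
    have t0: "t m > 0" using c by (simp add: t_def c_def)
    \<comment> \<open>Markov's inequality: every entry above the threshold contributes at least
      \<open>t m powr p\<close> to a sum of at most \<open>c powr p\<close>, and the quotient of the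
      two is \<open>2 powr (d * J)\<close>.\<close>
    have "real (card (W m)) * t m powr p = (\<Sum>i\<in>W m. t m powr p)" by simp
    also have "\<dots> \<le> (\<Sum>i\<in>W m. \<bar>x i\<bar> powr p)"
      using False p t0 by (intro sum_mono powr_mono2) (auto simp: W_def)
    also have "\<dots> \<le> (\<Sum>i\<in>P m. \<bar>x i\<bar> powr p)"
      by (intro sum_mono2 finite_block) (auto simp: W_def)
    also have "\<dots> \<le> c powr p" using x by (simp add: block_ball_def c_def)
    finally have "real (card (W m)) \<le> 2 powr (real d * real J)"
      using c by (simp add: t field_simps)
    then have "real (card (W m)) \<le> real (2 ^ (d * J))" by (simp add: two_power_dm)
    then have "card (W m) \<le> 2 ^ (d * J)" by (simp only: of_nat_le_iff)
    also have "\<dots> \<le> A * 2 ^ (d * J)" using A_pos by simp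
    finally show ?thesis .
  qed
  then have "(\<Sum>m<n. card (W m)) \<le> (\<Sum>m<n. A * 2 ^ (d * J))" by (intro sum_mono)
  moreover have "card (\<Union>m<n. W m) \<le> (\<Sum>m<n. card (W m))" by (rule card_UN_le) simp
  ultimately show ?thesis by (simp add: W_def)
qed

text \<open>Per block the squared error is bounded by three terms: \<open>e1\<close> for rounding to
  the grid of width \<open>h\<close>, \<open>e2\<close> for entries below the threshold,
  \<open>e3\<close> for the blocks beyond \<open>K * J\<close>, which are dropped. The hypotheses on
  \<open>H\<close> and \<open>K\<close> bring the sums of \<open>e1\<close> and \<open>e3\<close>
  down to the order \<open>2 powr (- 2 * \<sigma> * J)\<close>, which the sum of \<open>e2\<close>
  has by itself.\<close>

lemma block_ball_approx:
  fixes K H J C :: nat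
  assumes x: "x \<in> block_ball P p (real C) \<beta>" and p: "0 < p" "p \<le> 2" and C: "1 \<le> C" and \<beta>: "0 < \<beta>"
    and \<sigma>: "\<sigma> = \<beta> + real d * (1 / p - 1 / 2)"
    and K: "\<sigma> \<le> \<beta> * real K" and H: "real d * real K + 1 + 2 * \<sigma> \<le> 2 * real H"
  defines "h \<equiv> 2 powr (- (real H * real J))" and "n \<equiv> Suc (K * J)"
    and "Z \<equiv> \<Sum>m. 2 powr (- (2 * \<beta>) * real m)"
  shows "\<exists>xs. set xs \<subseteq> (\<Union>m<n. P m) \<times> {- int (C * 2 ^ (H * J)) .. int (C * 2 ^ (H * J))} \<and>
     length xs = n * (A * 2 ^ (d * J)) \<and>
     l2dist x (sparse_decode h xs) \<le> sqrt (real (K + 1) * A + 2 * (real C)\<^sup>2 * Z) * 2 powr (- \<sigma> * real J)"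
proof -
  have C0: "0 < real C" using C by simp
  define F where "F = (\<Union>m<n. P m)"
  define t where "t m = real C * 2 powr (- \<beta> * real m) * 2 powr (- (real d * real J / p))" for m
  define W where "W = (\<Union>m<n. if m \<le> J then P m else {i \<in> P m. t m < \<bar>x i\<bar>})"
  have h: "h > 0" by (simp add: h_def)
  have hinv: "1 / h = 2 ^ (H * J)"
  proof -
    have "1 / h = 2 powr real (H * J)" by (simp add: h_def powr_minus_divide)
    then show ?thesis by (simp only: powr_realpow zero_less_numeral)
  qed
  have finF: "finite F" using finite_block by (simp add: F_def)
  have WF: "W \<subseteq> F" by (auto simp: W_def F_def split: if_splits)
  have "P 0 \<noteq> {}" using card_block_pos[of 0] by auto
  then have Fne: "F \<noteq> {}" by (auto simp: F_def n_def)
  have cW: "card W \<le> n * (A * 2 ^ (d * J))"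
    unfolding W_def t_def by (rule block_ball_large_entries[OF x p(1) C0])
  obtain ws where ws: "length ws = n * (A * 2 ^ (d * J))" "W \<subseteq> set ws" "set ws \<subseteq> F"
    by (rule list_covering_set[OF finite_subset[OF WF finF] cW WF Fne])
  define Q where "Q i = \<lfloor>x i / h\<rfloor>" for i
  define xs where "xs = map (\<lambda>i. (i, Q i)) ws"
  define y where "y = sparse_decode h xs"
  have y: "y i = (if i \<in> set ws then h * of_int (Q i) else 0)" for i
    by (simp add: y_def xs_def sparse_decode_map)
  have Qr: "Q i \<in> {- int (C * 2 ^ (H * J)) .. int (C * 2 ^ (H * J))}" for i
  proof -
    define g where "g = int (C * 2 ^ (H * J))"
    have "\<bar>x i\<bar> * (1 / h) \<le> C * 2 ^ (H * J)" unfolding hinv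
      using block_ball_abs_le[OF x p(1) C0 \<beta>, of i] by (simp add: mult_right_mono)
    then have "\<bar>x i / h\<bar> \<le> of_int g" using h by (simp add: g_def)
    then have "of_int (- g) \<le> x i / h" "x i / h < of_int g + 1"
      unfolding abs_le_iff by auto
    then show ?thesis unfolding Q_def g_def[symmetric] by (simp add: le_floor_iff floor_le_iff)
  qed
  have qerr: "(x i - h * of_int (Q i))\<^sup>2 \<le> h\<^sup>2" for i
  proof -
    have "of_int (Q i) \<le> x i / h" "x i / h \<le> of_int (Q i) + 1" by (auto simp: Q_def)
    then have "h * of_int (Q i) \<le> x i" "x i \<le> h * of_int (Q i) + h" using h by (auto simp: field_simps)
    then show ?thesis using h by (intro power_mono) auto
  qed
  define c where "c m = real C * 2 powr (- \<beta> * real m)" for m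
  have csq: "(c m)\<^sup>2 = (real C)\<^sup>2 * 2 powr (- (2 * \<beta>) * real m)" for m
    by (simp add: c_def power_mult_distrib powr_power algebra_simps)
  \<comment> \<open>\<open>w2 * 2 powr (- 2 * \<beta> * m)\<close> is the value of
    \<open>t m powr (2 - p) * c m powr p\<close>, the bound of \<open>sum_squares_le_powr\<close>
    for the discarded entries.\<close>
  define w2 where "w2 = (real C)\<^sup>2 * 2 powr (real d * real J * (1 - 2 / p))"
  define e1 where "e1 m = (if m < n then A * 2 powr (real d * real (K * J)) * h\<^sup>2 else 0)" for m
  define e2 where "e2 m = (if m < J then 0 else w2 * 2 powr (- (2 * \<beta>) * real m))" for m
  define e3 where "e3 m = (if m < K * J then 0 else (real C)\<^sup>2 * 2 powr (- (2 * \<beta>) * real m))" for m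
  have e_nonneg: "0 \<le> e1 m" "0 \<le> e2 m" "0 \<le> e3 m" for m by (auto simp: e1_def e2_def e3_def w2_def)
  have blk: "(\<Sum>i\<in>P m. (x i - y i)\<^sup>2) \<le> e1 m + e2 m + e3 m" for m
  proof (cases "m < n")
    case True
    have "(\<Sum>i\<in>P m. (x i - y i)\<^sup>2) \<le> (\<Sum>i\<in>P m. h\<^sup>2 + (if i \<in> set ws then 0 else (x i)\<^sup>2))"
      using qerr by (intro sum_mono) (auto simp: y)
    also have "\<dots> = card (P m) * h\<^sup>2 + (\<Sum>i\<in>P m - set ws. (x i)\<^sup>2)"
      using finite_block[of m] by (simp add: sum.distrib sum.If_cases Diff_eq)
    also have "card (P m) * h\<^sup>2 \<le> e1 m"
    proof -
      have "real (card (P m)) \<le> A * 2 powr (real d * real m)" by (rule card_block_le_real)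
      also have "\<dots> \<le> A * 2 powr (real d * real (K * J))"
        using True by (intro mult_left_mono powr_mono of_nat_mono) (auto simp: n_def simp del: of_nat_mult)
      finally show ?thesis using True by (simp add: e1_def mult_right_mono)
    qed
    also have "(\<Sum>i\<in>P m - set ws. (x i)\<^sup>2) \<le> e2 m"
    proof (cases "m \<le> J")
      case mJ: True
      have "P m - set ws = {}" using ws(2) True mJ by (auto simp: W_def)
      then have "(\<Sum>i\<in>P m - set ws. (x i)\<^sup>2) = 0" by (simp only: sum.empty)
      then show ?thesis using e_nonneg by simp
    next
      case mJ: False
      have tx: "\<bar>x i\<bar> \<le> t m" if "i \<in> P m - set ws" for i
        using that ws(2) True mJ by (force simp: W_def)
      have c0: "c m > 0" using C0 by (simp add: c_def)
      have tc: "t m = c m * 2 powr (- (real d * real J / p))" by (simp add: t_def c_def)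
      have "(\<Sum>i\<in>P m - set ws. (x i)\<^sup>2) \<le> t m powr (2 - p) * (\<Sum>i\<in>P m - set ws. \<bar>x i\<bar> powr p)"
        using p tx by (rule sum_squares_le_powr)
      also have "\<dots> \<le> t m powr (2 - p) * (\<Sum>i\<in>P m. \<bar>x i\<bar> powr p)"
        using finite_block by (intro mult_left_mono sum_mono2) auto
      also have "\<dots> \<le> t m powr (2 - p) * c m powr p"
        using x by (intro mult_left_mono) (auto simp: block_ball_def c_def)
      also have "\<dots> = (c m powr (2 - p) * c m powr p) * 2 powr (- (real d * real J / p) * (2 - p))"
        using c0 by (simp add: tc powr_mult powr_powr)
      also have "c m powr (2 - p) * c m powr p = (c m)\<^sup>2" using c0 by (simp flip: powr_add)
      also have "- (real d * real J / p) * (2 - p) = real d * real J * (1 - 2 / p)"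
        using p by (simp add: field_simps)
      also have "(c m)\<^sup>2 * 2 powr (real d * real J * (1 - 2 / p)) = e2 m"
        using mJ by (simp add: e2_def w2_def csq)
      finally show ?thesis .
    qed
    finally show ?thesis using e_nonneg(3)[of m] by simp
  next
    case False
    have "i \<notin> F" if "i \<in> P m" for i
      using that False disjoint_family_onD[OF disjoint_blocks, of m] by (force simp: F_def)
    then have "(\<Sum>i\<in>P m. (x i - y i)\<^sup>2) = (\<Sum>i\<in>P m. (x i)\<^sup>2)"
      using ws(3) by (intro sum.cong) (auto simp: y)
    also have "\<dots> \<le> (c m)\<^sup>2" unfolding c_def by (rule block_ball_sum_squares[OF x p C0])
    also have "\<dots> = e3 m" using False by (simp add: csq e3_def n_def)
    finally show ?thesis using e_nonneg(1,2)[of m] by simp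
  qed
  have s1: "e1 sums (real n * (A * 2 powr (real d * real (K * J)) * h\<^sup>2))"
    using sums_If_finite_set[of "{..<n}" "\<lambda>_. A * 2 powr (real d * real (K * J)) * h\<^sup>2"]
    by (simp add: e1_def[abs_def])
  have s2: "e2 sums (w2 * 2 powr (- (2 * \<beta>) * real J) * Z)"
    unfolding e2_def[abs_def] Z_def using \<beta> by (intro geometric_tail_sums) auto
  have s3: "e3 sums ((real C)\<^sup>2 * 2 powr (- (2 * \<beta>) * real (K * J)) * Z)"
    unfolding e3_def[abs_def] Z_def using \<beta> by (intro geometric_tail_sums) auto
  note s = sums_add[OF sums_add[OF s1 s2] s3]
  have Z0: "0 \<le> Z" unfolding Z_def using summable_two_powr[of "2 * \<beta>"] \<beta> by (intro suminf_nonneg) auto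
  define D where "D = 2 powr (- (2 * \<sigma>) * real J)"
  have t1: "real n * (A * 2 powr (real d * real (K * J)) * h\<^sup>2) \<le> (real (K + 1) * A) * D"
  proof -
    \<comment> \<open>Turning the number of blocks into an exponential accounts for the summand 1 in
      the hypothesis on \<open>H\<close>.\<close>
    have "n \<le> (K + 1) * 2 ^ J"
    proof -
      have "K * J \<le> K * 2 ^ J" by (intro mult_left_mono) (simp_all add: less_imp_le[OF less_exp])
      moreover have "1 \<le> (2::nat) ^ J" by simp
      ultimately show ?thesis unfolding n_def add_mult_distrib mult_1 by linarith
    qed
    then have "real n \<le> real ((K + 1) * 2 ^ J)" by (simp only: of_nat_le_iff)
    also have "\<dots> = real (K + 1) * 2 powr real J"
      by (simp only: of_nat_mult of_nat_power of_nat_numeral powr_realpow zero_less_numeral)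
    finally have "real n * (A * 2 powr (real d * real (K * J)) * h\<^sup>2)
        \<le> (real (K + 1) * 2 powr real J) * (A * 2 powr (real d * real (K * J)) * h\<^sup>2)"
      by (intro mult_right_mono) auto
    also have "\<dots> = (real (K + 1) * A) * (2 powr real J * 2 powr (real d * real (K * J)) * h\<^sup>2)" by simp
    also have "2 powr real J * 2 powr (real d * real (K * J)) * h\<^sup>2
        = 2 powr (real J * (1 + real d * real K - 2 * real H))"
      by (simp add: h_def powr_power flip: powr_add) (simp add: algebra_simps)
    also have "(real (K + 1) * A) * \<dots> \<le> (real (K + 1) * A) * D"
      unfolding D_def
    proof (intro mult_left_mono powr_mono)
      have "real J * (1 + real d * real K - 2 * real H) \<le> real J * (- (2 * \<sigma>))"
        using H by (intro mult_left_mono) auto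
      then show "real J * (1 + real d * real K - 2 * real H) \<le> - (2 * \<sigma>) * real J" by (simp add: mult.commute)
    qed auto
    finally show ?thesis .
  qed
  have t2: "w2 * 2 powr (- (2 * \<beta>) * real J) * Z \<le> (real C)\<^sup>2 * Z * D"
  proof -
    \<comment> \<open>The definition of \<sigma> enters here: the gain from the threshold and the
      block decay at \<open>m = J\<close> multiply to exactly \<open>D\<close>.\<close>
    have "2 powr (real d * real J * (1 - 2 / p)) * 2 powr (- (2 * \<beta>) * real J) = D"
      by (simp add: D_def \<sigma> flip: powr_add) (simp add: algebra_simps)
    then show ?thesis by (simp add: w2_def mult.assoc mult.left_commute)
  qed
  have t3: "(real C)\<^sup>2 * 2 powr (- (2 * \<beta>) * real (K * J)) * Z \<le> (real C)\<^sup>2 * Z * D"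
  proof -
    have "\<sigma> * real J \<le> \<beta> * real K * real J" using K by (intro mult_right_mono) auto
    then have "2 powr (- (2 * \<beta>) * real (K * J)) \<le> D"
      unfolding D_def by (intro powr_mono) (auto simp: algebra_simps)
    then have "(real C)\<^sup>2 * Z * 2 powr (- (2 * \<beta>) * real (K * J)) \<le> (real C)\<^sup>2 * Z * D"
      using Z0 by (intro mult_left_mono) auto
    then show ?thesis by (simp only: mult_ac)
  qed
  have "l2dist x y \<le> sqrt (real (K + 1) * A + 2 * (real C)\<^sup>2 * Z) * 2 powr (- \<sigma> * real J)"
  proof (rule l2dist_blocks[OF _ _ blk])
    show "x \<in> l2space" using block_ball_subset_l2space[OF p C0 \<beta>] x by auto
    show "y \<in> l2space" by (simp add: y_def sparse_decode_in_l2space)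
    show "summable (\<lambda>m. e1 m + e2 m + e3 m)" using s by (rule sums_summable)
    have "(\<Sum>m. e1 m + e2 m + e3 m) \<le> (real (K + 1) * A) * D + (real C)\<^sup>2 * Z * D + (real C)\<^sup>2 * Z * D"
      using t1 t2 t3 sums_unique[OF s, symmetric] by linarith
    also have "\<dots> = (real (K + 1) * A + 2 * (real C)\<^sup>2 * Z) * D" by (simp add: algebra_simps)
    also have "D = (2 powr (- \<sigma> * real J))\<^sup>2" by (simp add: D_def powr_power mult.commute mult.left_commute)
    finally show "(\<Sum>m. e1 m + e2 m + e3 m) \<le>
        (sqrt (real (K + 1) * A + 2 * (real C)\<^sup>2 * Z) * 2 powr (- \<sigma> * real J))\<^sup>2"
      using Z0 by (simp add: power_mult_distrib)
  qed (use Z0 in auto)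
  then show ?thesis using ws Qr
    by (intro exI[of _ xs]) (auto simp: y_def xs_def F_def)
qed

text \<open>Positions and grid values are each exponential in \<open>J\<close> in number, so one
  pair costs a multiple of \<open>J + 1\<close> bits. Estimates such as \<open>A < 2 ^ A\<close> are
  crude but keep all bounds powers of two.\<close>

lemma card_sparse_codes:
  fixes C H J K :: nat
  assumes C: "1 \<le> C"
  defines "n \<equiv> Suc (K * J)" and "G \<equiv> int (C * 2 ^ (H * J))"
  shows "card ((\<Union>m<n. P m) \<times> {- G..G}) \<le> 2 ^ ((K + d * K + H + A + C + 3) * (J + 1))"
proof -
  have "card (\<Union>m<n. P m) \<le> (\<Sum>m<n. card (P m))" by (rule card_UN_le) simp
  also have "\<dots> \<le> (\<Sum>m<n. A * 2 ^ (d * (K * J)))"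
  proof (rule sum_mono)
    fix m assume "m \<in> {..<n}"
    then have "A * 2 ^ (d * m) \<le> A * 2 ^ (d * (K * J))"
      by (intro mult_left_mono power_increasing) (auto simp: n_def)
    then show "card (P m) \<le> A * 2 ^ (d * (K * J))" using card_le[of m] by linarith
  qed
  also have "\<dots> = n * (A * 2 ^ (d * (K * J)))" by simp
  also have "\<dots> \<le> 2 ^ n * (2 ^ A * 2 ^ (d * (K * J)))"
    by (intro mult_mono) (simp_all add: less_imp_le[OF less_exp])
  finally have 1: "card (\<Union>m<n. P m) \<le> 2 ^ (n + A + d * (K * J))" by (simp add: power_add mult.assoc)
  have "card {- G..G} = 2 * (C * 2 ^ (H * J)) + 1" by (simp add: G_def nat_add_distrib nat_mult_distrib nat_power_eq)
  also have "\<dots> \<le> 4 * (C * 2 ^ (H * J))" using C by simp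
  also have "\<dots> \<le> 4 * (2 ^ C * 2 ^ (H * J))"
    by (intro mult_mono) (simp_all add: less_imp_le[OF less_exp])
  finally have 2: "card {- G..G} \<le> 2 ^ (C + H * J + 2)" by (simp add: power_add)
  have "card ((\<Union>m<n. P m) \<times> {- G..G}) \<le> 2 ^ (n + A + d * (K * J)) * 2 ^ (C + H * J + 2)"
    unfolding card_cartesian_product by (intro mult_mono 1 2) auto
  also have "\<dots> = 2 ^ ((n + A + d * (K * J)) + (C + H * J + 2))" by (simp add: power_add)
  also have "\<dots> \<le> 2 ^ ((K + d * K + H + A + C + 3) * (J + 1))"
    by (intro power_increasing) (auto simp: n_def algebra_simps)
  finally show ?thesis .
qed

text \<open>The net consists of all decodings of lists whose length \<open>k\<close> has order
  \<open>(J + 1) * 2 ^ (d * J)\<close>; each list element takes \<open>c * (J + 1)\<close> bits,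
  which explains the square. \<open>K\<close> and \<open>H\<close> exist by the Archimedean property
  and are independent of \<open>J\<close>.\<close>

lemma block_ball_nets:
  fixes C :: nat
  assumes p: "0 < p" "p \<le> 2" and C: "1 \<le> C" and \<beta>: "0 < \<beta>"
    and \<sigma>: "\<sigma> = \<beta> + real d * (1 / p - 1 / 2)"
  obtains L :: nat and C1 :: real where "L \<ge> 1"
    "\<forall>J. \<exists>N. finite N \<and> N \<subseteq> l2space \<and> card N \<le> 2 ^ (L * (J + 1)\<^sup>2 * 2 ^ (d * J)) \<and>
       (\<forall>x\<in>block_ball P p (real C) \<beta>. \<exists>y\<in>N. l2dist x y \<le> C1 * 2 powr (- \<sigma> * real J))"
proof -
  obtain K :: nat where K: "\<sigma> / \<beta> \<le> real K" using real_arch_simple by blast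
  then have K: "\<sigma> \<le> \<beta> * real K" using \<beta> by (simp add: field_simps)
  obtain H :: nat where H: "(real d * real K + 1 + 2 * \<sigma>) / 2 \<le> real H" using real_arch_simple by blast
  then have H: "real d * real K + 1 + 2 * \<sigma> \<le> 2 * real H" by simp
  define c where "c = K + d * K + H + A + C + 3"
  show ?thesis
  proof (rule that[OF _ allI])
    show "1 \<le> c * (K + 1) * A" using A_pos by (simp add: c_def)
    fix J
    define X where "X = (\<Union>m<Suc (K * J). P m) \<times> {- int (C * 2 ^ (H * J)) .. int (C * 2 ^ (H * J))}"
    define k where "k = Suc (K * J) * (A * 2 ^ (d * J))"
    have finX: "finite X" using finite_block by (simp add: X_def)
    define N where "N = sparse_decode (2 powr (- (real H * real J))) ` {xs. set xs \<subseteq> X \<and> length xs = k}"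
    have "card N \<le> card X ^ k"
      unfolding N_def card_lists_length_eq[OF finX, symmetric]
      by (rule card_image_le[OF finite_lists_length_eq[OF finX]])
    also have "\<dots> \<le> (2 ^ (c * (J + 1))) ^ k"
      unfolding X_def c_def by (intro power_mono card_sparse_codes C) auto
    also have "\<dots> = 2 ^ (c * (J + 1) * k)" by (simp add: power_mult)
    also have "\<dots> \<le> 2 ^ (c * (K + 1) * A * (J + 1)\<^sup>2 * 2 ^ (d * J))"
    proof (intro power_increasing)
      have "c * (J + 1) * k = c * (J + 1) * (A * 2 ^ (d * J)) * Suc (K * J)" by (simp only: k_def mult_ac)
      also have "\<dots> \<le> c * (J + 1) * (A * 2 ^ (d * J)) * ((K + 1) * (J + 1))"
        by (intro mult_left_mono) auto
      also have "\<dots> = c * (K + 1) * A * (J + 1)\<^sup>2 * 2 ^ (d * J)"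
        by (simp only: power2_eq_square mult_ac)
      finally show "c * (J + 1) * k \<le> c * (K + 1) * A * (J + 1)\<^sup>2 * 2 ^ (d * J)" .
    qed auto
    finally have "card N \<le> 2 ^ (c * (K + 1) * A * (J + 1)\<^sup>2 * 2 ^ (d * J))" .
    moreover have "finite N" unfolding N_def by (intro finite_imageI finite_lists_length_eq finX)
    moreover have "N \<subseteq> l2space" by (auto simp: N_def sparse_decode_in_l2space)
    moreover have "\<forall>x\<in>block_ball P p (real C) \<beta>. \<exists>y\<in>N. l2dist x y \<le>
        sqrt (real (K + 1) * A + 2 * (real C)\<^sup>2 * (\<Sum>m. 2 powr (- (2 * \<beta>) * real m))) * 2 powr (- \<sigma> * real J)"
      using block_ball_approx[OF _ p C \<beta> \<sigma> K H, of _ J] unfolding N_def X_def k_def by blast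
    ultimately show "\<exists>N. finite N \<and> N \<subseteq> l2space \<and> card N \<le> 2 ^ (c * (K + 1) * A * (J + 1)\<^sup>2 * 2 ^ (d * J)) \<and>
       (\<forall>x\<in>block_ball P p (real C) \<beta>. \<exists>y\<in>N. l2dist x y \<le>
        sqrt (real (K + 1) * A + 2 * (real C)\<^sup>2 * (\<Sum>m. 2 powr (- (2 * \<beta>) * real m))) * 2 powr (- \<sigma> * real J))"
      by blast
  qed
qed

text \<open>Because \<open>d * s < \<sigma>\<close>, the factor \<open>(J + 1)\<^sup>2\<close> fits
  into the gap between \<open>2 powr (d * J)\<close> and \<open>b powr J\<close> with
  \<open>b = 2 powr (\<sigma> / s)\<close>. This \<open>b\<close> makes the net error
  \<open>2 powr (- \<sigma> * J)\<close> equal to \<open>b powr (- s * J)\<close>.\<close>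

lemma codec_achieves_block_ball:
  fixes C :: nat
  assumes p: "0 < p" "p \<le> 2" and C: "1 \<le> C" and \<beta>: "0 < \<beta>"
    and s: "0 < s" "s < \<beta> / real d + 1 / p - 1 / 2"
  shows "codec_achieves (block_ball P p (real C) \<beta>) s"
proof -
  define \<sigma> where "\<sigma> = \<beta> + real d * (1 / p - 1 / 2)"
  have "real d * s < \<sigma>"
  proof -
    have "real d * s < real d * (\<beta> / real d + 1 / p - 1 / 2)"
      using s d_pos by (intro mult_strict_left_mono) auto
    also have "\<dots> = \<sigma>" using d_pos p by (simp add: \<sigma>_def field_simps)
    finally show ?thesis .
  qed
  then have \<delta>: "\<sigma> / s - real d > 0" using s by (simp add: field_simps)
  obtain M where M: "M > 0" "\<forall>n::nat. (real n + 1)\<^sup>2 \<le> M * 2 powr ((\<sigma> / s - real d) * real n)"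
    by (rule square_le_exponential[OF \<delta>])
  obtain L :: nat and C1 :: real where L: "L \<ge> 1" and
    net: "\<forall>J. \<exists>N. finite N \<and> N \<subseteq> l2space \<and> card N \<le> 2 ^ (L * (J + 1)\<^sup>2 * 2 ^ (d * J)) \<and>
       (\<forall>x\<in>block_ball P p (real C) \<beta>. \<exists>y\<in>N. l2dist x y \<le> C1 * 2 powr (- \<sigma> * real J))"
    by (rule block_ball_nets[OF p C \<beta> \<sigma>_def])
  define b where "b = 2 powr (\<sigma> / s)"
  have C0: "0 < real C" using C by simp
  show ?thesis
  proof (rule codec_achieves_of_geometric_nets[where b = b and L = "real L * M" and ?C1.0 = C1])
    have "\<sigma> / s > 0" using \<delta> by (smt (verit) of_nat_0_le_iff)
    then have "(2::real) powr 0 < b" unfolding b_def by (intro powr_less_mono) auto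
    then show "b > 1" by simp
    show "0 < real L * M" using L M by simp
    show "l2dist x (\<lambda>_. 0) \<le> sqrt (\<Sum>m. (real C * 2 powr (- \<beta> * real m))\<^sup>2)"
      if x: "x \<in> block_ball P p (real C) \<beta>" for x
    proof (rule l2dist_blocks[OF _ _ _ summable_block_ball_bound[OF \<beta>]])
      show "(\<Sum>i\<in>P m. (x i - 0)\<^sup>2) \<le> (real C * 2 powr (- \<beta> * real m))\<^sup>2" for m
        using block_ball_sum_squares[OF x p C0, of m] by simp
      have "0 \<le> (\<Sum>m. (real C * 2 powr (- \<beta> * real m))\<^sup>2)"
        by (intro suminf_nonneg summable_block_ball_bound \<beta>) auto
      then show "(\<Sum>m. (real C * 2 powr (- \<beta> * real m))\<^sup>2) \<le> (sqrt (\<Sum>m. (real C * 2 powr (- \<beta> * real m))\<^sup>2))\<^sup>2"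
        "0 \<le> sqrt (\<Sum>m. (real C * 2 powr (- \<beta> * real m))\<^sup>2)" by auto
    qed (use x block_ball_subset_l2space[OF p C0 \<beta>] in auto)
    fix J :: nat
    have bs: "b powr (- s * real J) = 2 powr (- \<sigma> * real J)" using s by (simp add: b_def powr_powr)
    obtain N where N: "finite N" "N \<subseteq> l2space" "card N \<le> 2 ^ (L * (J + 1)\<^sup>2 * 2 ^ (d * J))"
      "\<forall>x\<in>block_ball P p (real C) \<beta>. \<exists>y\<in>N. l2dist x y \<le> C1 * 2 powr (- \<sigma> * real J)"
      using net[rule_format, of J] by (elim exE conjE)
    have "real (card N) \<le> real (2 ^ (L * (J + 1)\<^sup>2 * 2 ^ (d * J)))" using N(3) by (simp only: of_nat_le_iff)
    also have "\<dots> = 2 powr real (L * (J + 1)\<^sup>2 * 2 ^ (d * J))" by (subst powr_realpow) auto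
    also have "\<dots> \<le> 2 powr (real L * M * b powr real J)"
    proof (intro powr_mono)
      have "real (L * (J + 1)\<^sup>2 * 2 ^ (d * J)) = real L * (real J + 1)\<^sup>2 * 2 powr (real d * real J)"
        by (simp add: two_power_dm add.commute)
      also have "\<dots> \<le> real L * (M * 2 powr ((\<sigma> / s - real d) * real J)) * 2 powr (real d * real J)"
        by (intro mult_right_mono mult_left_mono M(2)[rule_format]) auto
      also have "\<dots> = real L * M * (2 powr ((\<sigma> / s - real d) * real J) * 2 powr (real d * real J))"
        by simp
      also have "2 powr ((\<sigma> / s - real d) * real J) * 2 powr (real d * real J) = b powr real J"
        by (simp add: b_def powr_powr algebra_simps flip: powr_add)
      finally show "real (L * (J + 1)\<^sup>2 * 2 ^ (d * J)) \<le> real L * M * b powr real J" .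
    qed auto
    finally show "\<exists>N. finite N \<and> N \<subseteq> l2space \<and> real (card N) \<le> 2 powr (real L * M * b powr real J) \<and>
      (\<forall>x\<in>block_ball P p (real C) \<beta>. \<exists>y\<in>N. l2dist x y \<le> C1 * b powr (- s * real J))"
      using N bs by auto
  qed (use s in auto)
qed

end

section \<open>Small balls of random signs\<close>

text \<open>The Rademacher distribution, moved to the Borel sets so that its infinite product lives
  on the Borel sets of the product topology.\<close>

definition coin :: "real measure" where
  "coin = distr (measure_pmf (pmf_of_set {-1, 1})) borel (\<lambda>x. x)"

text \<open>Coordinates are numbered by \<open>nat\<close>, which makes the product sigma-algebra
  the Borel one; the countable index set is injected into \<open>nat\<close> when the measure is
  transported.\<close>

definition signs :: "(nat \<Rightarrow> real) measure" where
  "signs = PiM UNIV (\<lambda>_. coin)"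

text \<open>Clipping makes the map from \<open>signs\<close> to the ball total; it changes nothing almost surely.\<close>
definition clip :: "real \<Rightarrow> real" where
  "clip v = max (-1) (min 1 v)"

lemma sets_coin [measurable_cong, simp]: "sets coin = sets borel"
  by (simp add: coin_def)

lemma prob_space_coin: "prob_space coin"
  unfolding coin_def by (rule measure_pmf.prob_space_distr) simp

lemma nn_integral_coin:
  assumes "g \<in> borel_measurable borel" and nn: "\<And>v. 0 \<le> g v"
  shows "(\<integral>\<^sup>+v. ennreal (g v) \<partial>coin) = ennreal ((g (-1) + g 1) / 2)"
proof -
  have "(\<integral>\<^sup>+v. ennreal (g v) \<partial>coin) = (\<integral>\<^sup>+v. ennreal (g v) \<partial>measure_pmf (pmf_of_set {-1, 1}))"
    unfolding coin_def using assms by (subst nn_integral_distr) auto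
  also have "\<dots> = (ennreal (g (-1)) + ennreal (g 1)) / 2"
    by (subst nn_integral_pmf_of_set) auto
  also have "\<dots> = ennreal (g (-1) + g 1) / ennreal 2" using nn by simp
  also have "\<dots> = ennreal ((g (-1) + g 1) / 2)" using nn by (intro divide_ennreal) auto
  finally show ?thesis .
qed

lemma sets_signs: "sets signs = sets borel"
proof -
  have "sets signs = sets (PiM UNIV (\<lambda>_::nat. borel :: real measure))"
    unfolding signs_def by (intro sets_PiM_cong) auto
  then show ?thesis by (simp add: sets_PiM_equal_borel)
qed

lemma space_signs [simp]: "space signs = UNIV"
  using sets_eq_imp_space_eq[OF sets_signs] by simp

lemma prob_space_signs: "prob_space signs"
  unfolding signs_def by (intro prob_space_PiM prob_space_coin)

text \<open>Independence of the coordinates: restriction to \<open>F\<close> turns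
  \<open>signs\<close> into a finite product measure, where the integral of a product
  factors.\<close>

lemma nn_integral_signs_prod:
  fixes g :: "nat \<Rightarrow> real \<Rightarrow> ennreal"
  assumes F: "finite F" and g: "\<And>j. g j \<in> borel_measurable borel"
  shows "(\<integral>\<^sup>+\<omega>. (\<Prod>j\<in>F. g j (\<omega> j)) \<partial>signs) = (\<Prod>j\<in>F. \<integral>\<^sup>+v. g j v \<partial>coin)"
proof -
  interpret product_prob_space "\<lambda>_::nat. coin" UNIV
    by (intro product_prob_spaceI prob_space_coin)
  have gc: "g j \<in> borel_measurable coin" for j using g by simp
  have "(\<Prod>j\<in>F. \<integral>\<^sup>+v. g j v \<partial>coin) = (\<integral>\<^sup>+\<omega>. (\<Prod>j\<in>F. g j (\<omega> j)) \<partial>PiM F (\<lambda>_. coin))"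
    by (rule product_nn_integral_prod[symmetric]) (use F gc in auto)
  also have "PiM F (\<lambda>_. coin) = distr signs (PiM F (\<lambda>_. coin)) (\<lambda>x. restrict x F)"
    unfolding signs_def by (rule distr_PiM_restrict_finite[symmetric]) (use F in auto)
  also have "(\<integral>\<^sup>+\<omega>. (\<Prod>j\<in>F. g j (\<omega> j)) \<partial>\<dots>) = (\<integral>\<^sup>+\<omega>. (\<Prod>j\<in>F. g j (restrict \<omega> F j)) \<partial>signs)"
  proof (rule nn_integral_distr)
    show "(\<lambda>x. restrict x F) \<in> measurable signs (PiM F (\<lambda>_. coin))"
      unfolding signs_def by (rule measurable_restrict_subset) auto
    have "(\<lambda>\<omega>. g j (\<omega> j)) \<in> borel_measurable (PiM F (\<lambda>_. coin))" if "j \<in> F" for j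
      using measurable_compose[OF measurable_component_singleton[of j F "\<lambda>_. coin", OF that] gc] .
    then have "(\<lambda>\<omega>. \<Prod>j\<in>F. g j (\<omega> j)) \<in> borel_measurable (PiM F (\<lambda>_. coin))"
      by (intro borel_measurable_prod_ennreal)
    then show "(\<lambda>\<omega>. \<Prod>j\<in>F. g j (\<omega> j)) \<in> borel_measurable
        (distr signs (PiM F (\<lambda>_. coin)) (\<lambda>x. restrict x F))" by simp
  qed
  finally show ?thesis by simp
qed

text \<open>One of the points -1 and 1 has distance at least 1 from \<open>y\<close> and contributes
  at most \<open>exp (-1) \<le> 1/2\<close>; the other contributes at most 1, so the mean is at most
  3/4.\<close>

lemma coin_exp_bound:
  fixes y :: real
  shows "(\<integral>\<^sup>+v. ennreal (exp (- (y - clip v)\<^sup>2)) \<partial>coin) \<le> ennreal (3 / 4)"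
proof -
  have "(\<integral>\<^sup>+v. ennreal (exp (- (y - clip v)\<^sup>2)) \<partial>coin)
      = ennreal ((exp (- (y - clip (-1))\<^sup>2) + exp (- (y - clip 1)\<^sup>2)) / 2)"
    by (rule nn_integral_coin) (simp_all add: clip_def)
  also have "\<dots> = ennreal ((exp (- (y + 1)\<^sup>2) + exp (- (y - 1)\<^sup>2)) / 2)"
    by (simp add: clip_def)
  also have "\<dots> \<le> ennreal (3 / 4)"
  proof (rule ennreal_leI)
    have "exp (-1) \<le> (1/2 :: real)"
      using exp_ge_add_one_self[of "1::real"] by (simp add: exp_minus field_simps)
    moreover have "exp (- (y + 1)\<^sup>2) \<le> 1" "exp (- (y - 1)\<^sup>2) \<le> 1" by auto
    moreover have "exp (- (y + 1)\<^sup>2) \<le> exp (-1) \<or> exp (- (y - 1)\<^sup>2) \<le> exp (-1)"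
    proof (cases "y \<ge> 0")
      case True
      then have "1 \<le> (y + 1)\<^sup>2" by (intro one_le_power) auto
      then show ?thesis by simp
    next
      case False
      then have "1 \<le> (1 - y)\<^sup>2" by (intro one_le_power) auto
      then show ?thesis by (simp add: power2_commute)
    qed
    ultimately show "(exp (- (y + 1)\<^sup>2) + exp (- (y - 1)\<^sup>2)) / 2 \<le> 3 / 4" by argo
  qed
  finally show ?thesis .
qed

text \<open>The Chernoff bound. Whatever \<open>x\<close> is, each coordinate is at distance at least \<open>r\<close> from it
  with probability at least 1/2.\<close>
lemma signs_small_ball:
  fixes x :: "'i \<Rightarrow> real" and e :: "'i \<Rightarrow> nat"
  assumes F: "finite F" and e: "inj_on e F" and r: "r > 0"
    and \<epsilon>: "\<epsilon>\<^sup>2 \<le> ln (8/7) * real (card F) * r\<^sup>2"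
  shows "measure signs {\<omega>. (\<Sum>i\<in>F. (x i - r * clip (\<omega> (e i)))\<^sup>2) \<le> \<epsilon>\<^sup>2} \<le> (6/7) ^ card F"
proof (cases "{\<omega>. (\<Sum>i\<in>F. (x i - r * clip (\<omega> (e i)))\<^sup>2) \<le> \<epsilon>\<^sup>2} \<in> sets signs")
  case True
  define A where "A = {\<omega>. (\<Sum>i\<in>F. (x i - r * clip (\<omega> (e i)))\<^sup>2) \<le> \<epsilon>\<^sup>2}"
  define g where "g j v = ennreal (exp (- (x (inv_into F e j) / r - clip v)\<^sup>2))" for j v
  have gm: "g j \<in> borel_measurable borel" for j unfolding g_def[abs_def] clip_def by measurable
  have "emeasure signs A = (\<integral>\<^sup>+\<omega>. indicator A \<omega> \<partial>signs)" using True by (simp add: A_def)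
  \<comment> \<open>Exponential Markov inequality: on \<open>A\<close> the new integrand is at least
    1 by the hypothesis on \<epsilon>. Each factor has mean at most 3/4, and 8/7 is chosen so that
    the product 6/7 is still below 1.\<close>
  also have "\<dots> \<le> (\<integral>\<^sup>+\<omega>. ennreal ((8/7) ^ card F) * (\<Prod>j\<in>e ` F. g j (\<omega> j)) \<partial>signs)"
  proof (rule nn_integral_mono)
    fix \<omega> :: "nat \<Rightarrow> real"
    show "indicator A \<omega> \<le> ennreal ((8/7) ^ card F) * (\<Prod>j\<in>e ` F. g j (\<omega> j))"
    proof (cases "\<omega> \<in> A")
      case True
      define q where "q = (\<Sum>i\<in>F. (x i / r - clip (\<omega> (e i)))\<^sup>2)"
      have "(x i - r * clip (\<omega> (e i)))\<^sup>2 = r\<^sup>2 * (x i / r - clip (\<omega> (e i)))\<^sup>2" for i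
        using r by (simp add: field_simps flip: power_mult_distrib)
      then have "r\<^sup>2 * q \<le> \<epsilon>\<^sup>2" using True by (simp add: A_def q_def sum_distrib_left)
      also have "\<dots> \<le> r\<^sup>2 * (ln (8/7) * real (card F))" using \<epsilon> by (simp add: mult_ac)
      finally have "q \<le> ln (8/7) * real (card F)" using r by simp
      then have "1 \<le> exp (ln (8/7) * real (card F) - q)" by simp
      also have "\<dots> = (8/7) ^ card F * exp (- q)"
        by (simp add: exp_diff exp_minus field_simps exp_of_nat_mult)
      finally have "1 \<le> (8/7) ^ card F * exp (- q)" .
      moreover have "(\<Prod>j\<in>e ` F. g j (\<omega> j)) = ennreal (exp (- q))"
        using e F by (simp add: prod.reindex g_def q_def prod_ennreal exp_sum sum_negf[symmetric])
      ultimately show ?thesis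
        by (simp add: indicator_def ennreal_mult[symmetric] ennreal_1[symmetric] del: ennreal_1)
    qed simp
  qed
  also have "\<dots> = ennreal ((8/7) ^ card F) * (\<integral>\<^sup>+\<omega>. (\<Prod>j\<in>e ` F. g j (\<omega> j)) \<partial>signs)"
  proof (rule nn_integral_cmult)
    have "(\<lambda>\<omega>. \<omega> j) \<in> measurable signs borel" for j :: nat
      unfolding signs_def using measurable_component_singleton[of j UNIV "\<lambda>_. coin"]
      by (simp add: measurable_cong_sets[OF refl sets_coin])
    then show "(\<lambda>\<omega>. \<Prod>j\<in>e ` F. g j (\<omega> j)) \<in> borel_measurable signs"
      by (intro borel_measurable_prod_ennreal measurable_compose[OF _ gm])
  qed
  also have "\<dots> = ennreal ((8/7) ^ card F) * (\<Prod>j\<in>e ` F. \<integral>\<^sup>+v. g j v \<partial>coin)"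
    using F gm by (subst nn_integral_signs_prod) auto
  also have "\<dots> \<le> ennreal ((8/7) ^ card F) * (\<Prod>j\<in>e ` F. ennreal (3/4))"
    unfolding g_def by (intro mult_left_mono prod_mono_ennreal coin_exp_bound) auto
  also have "\<dots> = ennreal ((8/7) ^ card F * (3/4) ^ card F)"
    using e by (simp add: card_image ennreal_mult ennreal_power)
  also have "(8/7) ^ card F * (3/4) ^ card F = (6/7 :: real) ^ card F"
    by (simp flip: power_mult_distrib)
  finally show ?thesis unfolding A_def measure_def by (intro enn2real_leI) auto
qed (simp add: measure_notin_sets)

section \<open>The law of scaled random signs on the ball\<close>

context finite_blocks
begin

text \<open>\<open>M\<close> is the image of \<open>signs\<close> under \<open>T\<close>, which
  scales coordinate \<open>e i\<close> by the radius of the block of \<open>i\<close>.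
  \<open>T\<close> is continuous into the product topology and thus, with values in
  \<open>S\<close>, into l2, hence Borel measurable. The l2 distance dominates the distance on each
  block, so any single block bounds the measure of a ball.\<close>

lemma random_signs_measure:
  fixes r :: "nat \<Rightarrow> real" and S :: "('i \<Rightarrow> real) set"
  assumes cnt: "countable (UNIV :: 'i set)" and r: "\<And>m. r m > 0"
    and S: "\<And>x. (\<And>m i. i \<in> P m \<Longrightarrow> \<bar>x i\<bar> \<le> r m) \<Longrightarrow> x \<in> S"
    and c: "summable c" and Sc: "\<And>x m. x \<in> S \<Longrightarrow> (\<Sum>i\<in>P m. (x i)\<^sup>2) \<le> c m"
  shows "\<exists>M. borel_prob_on S M \<and> (\<forall>x\<in>l2space. \<forall>\<epsilon>\<ge>0. \<forall>m. \<epsilon>\<^sup>2 \<le> ln (8/7) * real (card (P m)) * (r m)\<^sup>2 \<longrightarrow>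
     measure M (S \<inter> {y\<in>l2space. l2dist x y \<le> \<epsilon>}) \<le> (6/7) ^ card (P m))"
proof -
  define e where "e = to_nat_on (UNIV :: 'i set)"
  have e: "inj e" unfolding e_def by (rule inj_on_to_nat_on[OF cnt])
  define blk where "blk i = (THE m. i \<in> P m)" for i
  have blk: "blk i = m" if "i \<in> P m" for i m
    unfolding blk_def
  proof (rule the_equality)
    show "k = m" if "i \<in> P k" for k
      using that \<open>i \<in> P m\<close> disjoint_family_onD[OF disjoint_blocks, of k m] by auto
  qed fact
  define T where "T \<omega> i = r (blk i) * clip (\<omega> (e i))" for \<omega> i
  have TS: "T \<omega> \<in> S" for \<omega>
  proof (rule S)
    fix m i assume "i \<in> P m"
    then have "T \<omega> i = r m * clip (\<omega> (e i))" by (simp add: T_def blk)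
    moreover have "\<bar>clip (\<omega> (e i))\<bar> \<le> 1" by (auto simp: clip_def)
    ultimately show "\<bar>T \<omega> i\<bar> \<le> r m" using r[of m] by (simp add: abs_mult mult_left_le)
  qed
  have S2: "S \<subseteq> l2space" using l2space_blocks[OF Sc c] by blast
  have "continuous_on UNIV T"
    unfolding T_def clip_def
    by (intro continuous_on_coordinatewise_then_product continuous_intros continuous_on_product_coordinates)
  then have "continuous_map euclidean (top_of_set S) T"
    using TS by (auto simp: continuous_map_in_subtopology)
  from continuous_map_compose[OF this continuous_map_product_to_l2[OF c Sc]]
  have Tc: "continuous_map euclidean l2top T" by (simp add: o_def)
  have T: "T \<in> measurable signs (restrict_space l2borel S)"
  proof (rule measurable_restrict_space2)
    show "T \<in> space signs \<rightarrow> S" using TS by auto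
    show "T \<in> measurable signs l2borel"
      unfolding l2borel_def
    proof (rule measurable_measure_of)
      show "{U. openin l2top U} \<subseteq> Pow l2space" using openin_subset[of l2top] by auto
      show "T \<in> space signs \<rightarrow> l2space" using TS S2 by auto
      fix U :: "('i \<Rightarrow> real) set" assume "U \<in> {U. openin l2top U}"
      then have "open {\<omega>. T \<omega> \<in> U}" using openin_continuous_map_preimage[OF Tc, of U] by simp
      then show "T -` U \<inter> space signs \<in> sets signs" by (simp add: sets_signs vimage_def)
    qed
  qed
  define M where "M = distr signs (restrict_space l2borel S) T"
  have "borel_prob_on S M"
    unfolding borel_prob_on_def M_def
    using prob_space.prob_space_distr[OF prob_space_signs T] S2 by (auto simp: space_restrict_space)
  moreover have "measure M (S \<inter> {y\<in>l2space. l2dist x y \<le> \<epsilon>}) \<le> (6/7) ^ card (P m)"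
    if x: "x \<in> l2space" and \<epsilon>: "\<epsilon> \<ge> 0" "\<epsilon>\<^sup>2 \<le> ln (8/7) * real (card (P m)) * (r m)\<^sup>2" for x \<epsilon> m
  proof -
    interpret signs: prob_space signs by (rule prob_space_signs)
    define A where "A = {\<omega>. (\<Sum>i\<in>P m. (x i - r m * clip (\<omega> (e i)))\<^sup>2) \<le> \<epsilon>\<^sup>2}"
    have Am: "A \<in> sets signs"
    proof -
      have "continuous_on UNIV (\<lambda>\<omega>::nat \<Rightarrow> real. \<Sum>i\<in>P m. (x i - r m * clip (\<omega> (e i)))\<^sup>2)"
        unfolding clip_def by (intro continuous_intros continuous_on_product_coordinates)
      then have "closed A" unfolding A_def by (intro closed_Collect_le) auto
      then show ?thesis by (simp add: sets_signs)
    qed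
    have "S \<inter> {y\<in>l2space. l2dist x y \<le> \<epsilon>} \<in> sets (restrict_space l2borel S)"
      using closed_ball_sets_l2borel[OF x, of \<epsilon>] by (auto simp: sets_restrict_space)
    then have "measure M (S \<inter> {y\<in>l2space. l2dist x y \<le> \<epsilon>})
        = measure signs (T -` (S \<inter> {y\<in>l2space. l2dist x y \<le> \<epsilon>}) \<inter> space signs)"
      unfolding M_def by (rule measure_distr[OF T])
    also have "\<dots> \<le> measure signs A"
    proof (rule signs.finite_measure_mono[OF _ Am], safe)
      fix \<omega> assume y: "l2dist x (T \<omega>) \<le> \<epsilon>" "T \<omega> \<in> l2space"
      have "(\<Sum>i\<in>P m. (x i - r m * clip (\<omega> (e i)))\<^sup>2) = (\<Sum>i\<in>P m. (x i - T \<omega> i)\<^sup>2)"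
        by (intro sum.cong) (auto simp: T_def blk)
      also have "\<dots> \<le> (l2dist x (T \<omega>))\<^sup>2" by (rule sum_block_le_l2dist[OF x y(2)])
      also have "\<dots> \<le> \<epsilon>\<^sup>2" using y by (intro power_mono) (auto simp: l2dist_nonneg)
      finally show "\<omega> \<in> A" by (simp add: A_def)
    qed
    also have "\<dots> \<le> (6/7) ^ card (P m)"
      unfolding A_def using e by (intro signs_small_ball finite_block r \<epsilon>) (auto intro: inj_on_subset)
    finally show ?thesis .
  qed
  ultimately show ?thesis by blast
qed

end

text \<open>Union bound: balls of radius \<epsilon> of order \<open>R powr (- s)\<close> around the
  \<open>2 ^ R\<close> reconstruction points cover \<open>S\<close>, so
  \<open>c * \<epsilon> powr (- 1 / s') \<le> R\<close>. The left side has order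
  \<open>R powr (s / s')\<close>, which is impossible for large \<open>R\<close>.\<close>

lemma growth_order_rate_le:
  fixes S :: "('i \<Rightarrow> real) set"
  assumes M: "borel_prob_on S M" and S: "S \<subseteq> l2space" and g: "growth_order S M s0" and s0: "0 \<le> s0"
    and cod: "codec_achieves S s"
  shows "s \<le> s0"
proof (rule ccontr)
  assume "\<not> s \<le> s0"
  \<comment> \<open>The growth condition concerns exponents strictly above \<open>s0\<close>, and
    divergence of \<open>R powr (s / s' - 1)\<close> requires \<open>s' < s\<close>; the midpoint
    meets both.\<close>
  define s' where "s' = (s + s0) / 2"
  have s': "s0 < s'" "s' < s" "0 < s'" using \<open>\<not> s \<le> s0\<close> s0 by (auto simp: s'_def)
  obtain \<epsilon>0 c where \<epsilon>0: "\<epsilon>0 > 0" "c > 0" and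
    bnd: "\<And>x \<epsilon>. x \<in> l2space \<Longrightarrow> 0 < \<epsilon> \<Longrightarrow> \<epsilon> < \<epsilon>0 \<Longrightarrow>
      measure M (S \<inter> {y\<in>l2space. l2dist x y \<le> \<epsilon>}) \<le> 2 powr (- c * \<epsilon> powr (- 1 / s'))"
    using g s'(1) unfolding growth_order_def by blast
  obtain E :: "nat \<Rightarrow> ('i \<Rightarrow> real) \<Rightarrow> bool list" and D :: "nat \<Rightarrow> bool list \<Rightarrow> ('i \<Rightarrow> real)" and C where
    E: "\<forall>R. \<forall>x\<in>S. length (E R x) = R" and D: "\<forall>R bs. length bs = R \<longrightarrow> D R bs \<in> l2space"
    and C: "\<forall>R\<ge>1. \<forall>x\<in>S. real R powr s * l2dist x (D R (E R x)) \<le> C"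
    using cod unfolding codec_achieves_def by (elim exE conjE) (rule that)
  interpret prob_space M using M by (simp add: borel_prob_on_def)
  \<comment> \<open>The maximum with 1 makes the radius \<epsilon> positive, whatever the sign of
    \<open>C\<close>.\<close>
  define C' where "C' = max C 1"
  have C': "C' > 0" "C \<le> C'" by (auto simp: C'_def)
  define k where "k = c * C' powr (- 1 / s')"
  have k: "k > 0" using \<epsilon>0 C' by (simp add: k_def)
  have key: "k \<le> real R powr (1 - s / s')" if R: "R \<ge> 1" and small: "C' * real R powr (- s) < \<epsilon>0" for R
  proof -
    define \<epsilon> where "\<epsilon> = C' * real R powr (- s)"
    have \<epsilon>: "0 < \<epsilon>" "\<epsilon> < \<epsilon>0" using R small C' by (auto simp: \<epsilon>_def)
    define B where "B bs = S \<inter> {y\<in>l2space. l2dist (D R bs) y \<le> \<epsilon>}" for bs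
    define L where "L = {bs :: bool list. length bs = R}"
    have finL: "finite L" using finite_lists_length_eq[of "UNIV :: bool set" R] by (simp add: L_def)
    have cardL: "card L = 2 ^ R" using card_lists_length_eq[of "UNIV :: bool set" R] by (simp add: L_def)
    have Bm: "B bs \<in> sets M" if "bs \<in> L" for bs
      using M closed_ball_sets_l2borel[OF D[rule_format], of bs R \<epsilon>] that
      by (auto simp: borel_prob_on_def sets_restrict_space B_def L_def)
    have "space M \<subseteq> (\<Union>bs\<in>L. B bs)"
    proof
      fix x assume "x \<in> space M"
      then have x: "x \<in> S" using M by (simp add: borel_prob_on_def)
      have "real R powr s * l2dist x (D R (E R x)) \<le> C'" using C[rule_format, OF R x] C' by linarith
      then have "l2dist x (D R (E R x)) \<le> \<epsilon>" using R by (simp add: \<epsilon>_def powr_minus field_simps)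
      then show "x \<in> (\<Union>bs\<in>L. B bs)"
        using x S E[rule_format, OF x, of R] by (intro UN_I[of "E R x"]) (auto simp: L_def B_def l2.commute)
    qed
    then have "1 \<le> measure M (\<Union>bs\<in>L. B bs)"
      using finite_measure_mono[of "space M" "\<Union>bs\<in>L. B bs"] finL Bm prob_space by auto
    also have "\<dots> \<le> (\<Sum>bs\<in>L. measure M (B bs))"
      using finL Bm by (intro finite_measure_subadditive_finite) auto
    also have "\<dots> \<le> (\<Sum>bs\<in>L. 2 powr (- c * \<epsilon> powr (- 1 / s')))"
      unfolding B_def using D \<epsilon> by (intro sum_mono bnd) (auto simp: L_def)
    also have "\<dots> = 2 powr (real R - c * \<epsilon> powr (- 1 / s'))"
      by (simp add: cardL powr_diff powr_minus powr_realpow field_simps)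
    finally have "2 powr 0 \<le> 2 powr (real R - c * \<epsilon> powr (- 1 / s'))" by simp
    then have "c * \<epsilon> powr (- 1 / s') \<le> real R" by (subst (asm) powr_le_cancel_iff) auto
    moreover have "\<epsilon> powr (- 1 / s') = C' powr (- 1 / s') * real R powr (s / s')"
      using C' R by (simp add: \<epsilon>_def powr_mult powr_powr)
    ultimately have "k * real R powr (s / s') \<le> real R" by (simp add: k_def mult.assoc)
    then show ?thesis using R by (simp add: powr_diff field_simps)
  qed
  have "(\<lambda>R. C' * real R powr (- s)) \<longlonglongrightarrow> C' * 0"
    using s' by (intro tendsto_mult_left tendsto_neg_powr filterlim_real_sequentially) auto
  then have 1: "\<forall>\<^sub>F R in sequentially. C' * real R powr (- s) < \<epsilon>0"
    using \<epsilon>0 by (intro order_tendstoD) auto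
  have "(\<lambda>R. real R powr (1 - s / s')) \<longlonglongrightarrow> 0"
    using s' by (intro tendsto_neg_powr filterlim_real_sequentially) auto
  then have 2: "\<forall>\<^sub>F R in sequentially. real R powr (1 - s / s') < k"
    using k by (intro order_tendstoD) auto
  have "\<forall>\<^sub>F R in sequentially. False"
    using 1 2 eventually_ge_at_top[of 1] by eventually_elim (use key in force)
  then show False by simp
qed

section \<open>Growth order and the main theorem\<close>

text \<open>With \<open>w m = 1 / ((m + 1) * (m + 2))\<close>, a block with entries of this modulus
  has scaled norm \<open>w m powr inv_exp q\<close>. For finite \<open>q\<close> the
  \<open>q\<close>-th powers are \<open>w m\<close>, whose series telescopes to 1; for infinite
  \<open>q\<close> the scaled norms are 1.\<close>

definition sign_radius :: "ennreal \<Rightarrow> ennreal \<Rightarrow> real \<Rightarrow> (nat \<Rightarrow> 'i set) \<Rightarrow> nat \<Rightarrow> real" where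
  "sign_radius p q \<alpha> P m = real (card (P m)) powr (- inv_exp p) * 2 powr (- \<alpha> * real m) *
     (1 / ((real m + 1) * (real m + 2))) powr inv_exp q"

lemma inv_exp_nonneg: "0 \<le> inv_exp p"
  by (simp add: inv_exp_def)

section \<open>Sign vectors in the unit ball and their small-ball exponent\<close>

context regular_blocks
begin

lemma sign_radius_pos: "0 < sign_radius p q \<alpha> P m"
  unfolding sign_radius_def using card_block_pos[of m] by simp

lemma lp_norm_fin_le:
  assumes p: "p > 0" and x: "\<And>i. i \<in> P m \<Longrightarrow> \<bar>x i\<bar> \<le> r" and r: "0 < r"
  shows "lp_norm_fin p (P m) x \<le> real (card (P m)) powr inv_exp p * r"
proof (cases "p = \<infinity>")
  case True
  have "P m \<noteq> {}" using card_block_pos[of m] by auto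
  then show ?thesis using True x finite_block card_block_pos[of m]
    by (auto simp: lp_norm_fin_def inv_exp_def)
next
  case False
  have e: "0 < enn2real p" using enn2real_exponent_pos[OF p False] .
  have "(\<Sum>i\<in>P m. \<bar>x i\<bar> powr enn2real p) \<le> (\<Sum>i\<in>P m. r powr enn2real p)"
    using x e by (intro sum_mono powr_mono2) auto
  then have "lp_norm_fin p (P m) x \<le> (real (card (P m)) * r powr enn2real p) powr (1 / enn2real p)"
    using False e by (auto simp: lp_norm_fin_def intro!: powr_mono2 sum_nonneg)
  also have "\<dots> = real (card (P m)) powr inv_exp p * r"
    using False e r by (simp add: powr_mult powr_powr inv_exp_def)
  finally show ?thesis .
qed

lemma sum_inverse_consecutive: "(\<Sum>m<N. 1 / ((real m + 1) * (real m + 2))) = 1 - 1 / (real N + 1)"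
proof (induction N)
  case (Suc N)
  have "1 / ((real N + 1) * (real N + 2)) = 1 / (real N + 1) - 1 / (real N + 2)"
    by (simp add: divide_simps)
  then show ?case using Suc by (simp add: add.commute)
qed simp

lemma sign_box_subset_mixed_unit_ball:
  assumes p: "p > 0" and q: "q > 0"
    and x: "\<And>m i. i \<in> P m \<Longrightarrow> \<bar>x i\<bar> \<le> sign_radius p q \<alpha> P m"
  shows "x \<in> mixed_unit_ball p q \<alpha> P"
proof -
  define w where "w m = 1 / ((real m + 1) * (real m + 2))" for m :: nat
  have w: "0 < w m" for m by (simp add: w_def add_pos_pos)
  have n0: "0 \<le> scaled_norm p \<alpha> P x m" for m
    by (simp add: scaled_norm_def lp_norm_fin_nonneg finite_block)
  have n: "scaled_norm p \<alpha> P x m \<le> w m powr inv_exp q" for m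
  proof -
    have "scaled_norm p \<alpha> P x m \<le>
        2 powr (\<alpha> * real m) * (real (card (P m)) powr inv_exp p * sign_radius p q \<alpha> P m)"
      unfolding scaled_norm_def
      by (intro mult_left_mono lp_norm_fin_le p x sign_radius_pos) auto
    also have "\<dots> = (2 powr (\<alpha> * real m) * 2 powr (- \<alpha> * real m)) *
        (real (card (P m)) powr inv_exp p * real (card (P m)) powr (- inv_exp p)) * w m powr inv_exp q"
      by (simp only: sign_radius_def w_def mult_ac)
    also have "\<dots> = w m powr inv_exp q"
      using card_block_pos[of m] by (simp flip: powr_add)
    finally show ?thesis .
  qed
  show ?thesis
  proof (cases "q = \<infinity>")
    case True
    have "scaled_norm p \<alpha> P x m \<le> 1" for m
      using n[of m] w[of m] True by (simp add: inv_exp_def)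
    then show ?thesis unfolding mixed_unit_ball_iff[OF q finite_block] using True by simp
  next
    case False
    have e: "0 < enn2real q" using enn2real_exponent_pos[OF q False] .
    have "(\<Sum>m<N. scaled_norm p \<alpha> P x m powr enn2real q) \<le> 1" for N
    proof -
      have "(\<Sum>m<N. scaled_norm p \<alpha> P x m powr enn2real q) \<le> (\<Sum>m<N. w m)"
      proof (rule sum_mono)
        fix m
        have "scaled_norm p \<alpha> P x m powr enn2real q \<le> (w m powr inv_exp q) powr enn2real q"
          using e n n0 by (intro powr_mono2) auto
        also have "\<dots> = w m" using e w[of m] False by (simp add: powr_powr inv_exp_def)
        finally show "scaled_norm p \<alpha> P x m powr enn2real q \<le> w m" .
      qed
      also have "\<dots> \<le> 1" by (simp add: w_def sum_inverse_consecutive)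
      finally show ?thesis .
    qed
    then show ?thesis unfolding mixed_unit_ball_iff[OF q finite_block] using False by simp
  qed
qed

text \<open>The exponent \<open>1/2 - inv_exp p\<close> may have either sign; a nonnegative \<theta>
  uses the lower bound on the block sizes and a negative one the upper bound.\<close>

lemma card_powr_ge:
  obtains c where "c > 0" "\<forall>m. c * 2 powr (real d * \<theta> * real m) \<le> real (card (P m)) powr \<theta>"
proof (cases "\<theta> \<ge> 0")
  case True
  show ?thesis
  proof (rule that[of "a powr \<theta>"]; (intro allI)?)
    fix m
    have "(a * 2 powr (real d * real m)) powr \<theta> \<le> real (card (P m)) powr \<theta>"
      using card_ge[of m] a_pos True by (intro powr_mono2) (auto simp: two_power_dm)
    then show "a powr \<theta> * 2 powr (real d * \<theta> * real m) \<le> real (card (P m)) powr \<theta>"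
      by (simp add: powr_mult powr_powr mult_ac)
  qed (use a_pos in auto)
next
  case False
  show ?thesis
  proof (rule that[of "real A powr \<theta>"]; (intro allI)?)
    fix m
    have "(real A * 2 powr (real d * real m)) powr \<theta> \<le> real (card (P m)) powr \<theta>"
      using card_block_le_real[of m] card_block_pos[of m] False by (intro powr_mono2') auto
    then show "real A powr \<theta> * 2 powr (real d * \<theta> * real m) \<le> real (card (P m)) powr \<theta>"
      by (simp add: powr_mult powr_powr mult_ac)
  qed (use A_pos in auto)
qed

text \<open>The right-hand side is the largest radius that the Chernoff bound admits on block
  \<open>m\<close>. The polynomial weight in \<open>sign_radius\<close> is paid for by the
  arbitrarily small \<delta>.\<close>

lemma sign_radius_ge:
  assumes \<delta>: "\<delta> > 0"
  obtains c where "c > 0" "\<forall>m. c * 2 powr (- (\<alpha> - real d * (1/2 - inv_exp p) + \<delta>) * real m)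
    \<le> sqrt (ln (8/7) * real (card (P m))) * sign_radius p q \<alpha> P m"
proof -
  define \<iota> where "\<iota> = inv_exp q"
  have \<iota>: "\<iota> \<ge> 0" by (simp add: \<iota>_def inv_exp_nonneg)
  obtain c1 where c1: "c1 > 0"
    "\<forall>m. c1 * 2 powr (real d * (1/2 - inv_exp p) * real m) \<le> real (card (P m)) powr (1/2 - inv_exp p)"
    by (rule card_powr_ge)
  \<comment> \<open>The weight enters with power \<iota>, so this choice loses
    \<open>\<delta> * \<iota> / (\<iota> + 1)\<close>, at most \<delta>; adding 1 keeps the
    denominator positive when \<open>q\<close> is infinite.\<close>
  have "\<delta> / (\<iota> + 1) > 0" using \<delta> \<iota> by simp
  then obtain K where K: "K > 0" "\<forall>n::nat. (real n + 1)\<^sup>2 \<le> K * 2 powr (\<delta> / (\<iota> + 1) * real n)"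
    by (rule square_le_exponential)
  have w: "(2 * K) powr (- \<iota>) * 2 powr (- \<delta> * real m) \<le> (1 / ((real m + 1) * (real m + 2))) powr \<iota>" for m :: nat
  proof -
    have "(real m + 1) * (real m + 2) \<le> 2 * (real m + 1)\<^sup>2" by (simp add: power2_eq_square algebra_simps)
    also have "\<dots> \<le> 2 * (K * 2 powr (\<delta> / (\<iota> + 1) * real m))" using K(2) by (intro mult_left_mono) auto
    finally have "(2 * K * 2 powr (\<delta> / (\<iota> + 1) * real m)) powr (- \<iota>) \<le> ((real m + 1) * (real m + 2)) powr (- \<iota>)"
      using \<iota> by (intro powr_mono2') (auto simp: mult.assoc)
    also have "\<dots> = (1 / ((real m + 1) * (real m + 2))) powr \<iota>"
      by (simp add: powr_minus powr_divide inverse_eq_divide)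
    also have "(2 * K * 2 powr (\<delta> / (\<iota> + 1) * real m)) powr (- \<iota>)
        = (2 * K) powr (- \<iota>) * 2 powr (\<delta> / (\<iota> + 1) * real m * (- \<iota>))"
      by (simp only: powr_mult powr_powr)
    finally have *: "(2 * K) powr (- \<iota>) * 2 powr (\<delta> / (\<iota> + 1) * real m * (- \<iota>))
        \<le> (1 / ((real m + 1) * (real m + 2))) powr \<iota>" .
    have "\<delta> / (\<iota> + 1) * \<iota> \<le> \<delta>" using \<delta> \<iota> by (simp add: field_simps)
    then have "\<delta> / (\<iota> + 1) * \<iota> * real m \<le> \<delta> * real m" by (intro mult_right_mono) auto
    then have "- \<delta> * real m \<le> \<delta> / (\<iota> + 1) * real m * (- \<iota>)" by (simp add: mult_ac)
    then have "(2 * K) powr (- \<iota>) * 2 powr (- \<delta> * real m)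
        \<le> (2 * K) powr (- \<iota>) * 2 powr (\<delta> / (\<iota> + 1) * real m * (- \<iota>))"
      by (intro mult_left_mono powr_mono) auto
    then show ?thesis using * by linarith
  qed
  define c where "c = sqrt (ln (8/7)) * c1 * (2 * K) powr (- \<iota>)"
  have ln0: "0 < ln (8/7 :: real)" by simp
  show ?thesis
  proof (rule that[of c]; (intro allI)?)
    show "c > 0" using c1 K ln0 by (simp add: c_def)
    fix m
    define \<theta> where "\<theta> = 1/2 - inv_exp p"
    define n where "n = real (card (P m))"
    have n: "n > 0" using card_block_pos by (simp add: n_def)
    have ex: "- (\<alpha> - real d * (1/2 - inv_exp p) + \<delta>) * real m
        = real d * \<theta> * real m + - \<delta> * real m + - \<alpha> * real m"
      by (simp add: \<theta>_def algebra_simps)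
    have "c * 2 powr (- (\<alpha> - real d * (1/2 - inv_exp p) + \<delta>) * real m) =
       sqrt (ln (8/7)) * ((c1 * 2 powr (real d * \<theta> * real m)) *
        ((2 * K) powr (- \<iota>) * 2 powr (- \<delta> * real m)) * 2 powr (- \<alpha> * real m))"
      unfolding ex c_def powr_add by (simp only: mult_ac)
    also have "\<dots> \<le> sqrt (ln (8/7)) * (n powr \<theta> *
        (1 / ((real m + 1) * (real m + 2))) powr \<iota> * 2 powr (- \<alpha> * real m))"
      using c1 w[of m] K ln0
      by (intro mult_left_mono mult_right_mono mult_mono) (auto simp: n_def \<theta>_def)
    also have "n powr \<theta> = sqrt n * n powr (- inv_exp p)"
      using n powr_add[of n "1/2" "- inv_exp p"] by (simp add: \<theta>_def powr_half_sqrt)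
    also have "sqrt (ln (8/7)) * (sqrt n * n powr (- inv_exp p) *
        (1 / ((real m + 1) * (real m + 2))) powr \<iota> * 2 powr (- \<alpha> * real m)) =
        sqrt (ln (8/7) * n) * sign_radius p q \<alpha> P m"
      by (simp only: real_sqrt_mult sign_radius_def n_def \<iota>_def mult_ac)
    finally show "c * 2 powr (- (\<alpha> - real d * (1/2 - inv_exp p) + \<delta>) * real m)
        \<le> sqrt (ln (8/7) * real (card (P m))) * sign_radius p q \<alpha> P m" by (simp add: n_def)
  qed
qed

text \<open>For radius \<epsilon> one takes the last block \<open>m\<close> with
  \<open>c * 2 powr (- d * s * m)\<close> at least \<epsilon>. Its size is at least of order
  \<open>\<epsilon> powr (- 1 / s)\<close> and is the exponent in the bound for the ball. The slack
  \<open>d * (s - s0)\<close> turns the exponent of \<open>sign_radius_ge\<close> into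
  \<open>d * s\<close>.\<close>

lemma growth_order_signs:
  assumes M: "\<forall>x\<in>l2space. \<forall>\<epsilon>\<ge>0. \<forall>m. \<epsilon>\<^sup>2 \<le> ln (8/7) * real (card (P m)) * (sign_radius p q \<alpha> P m)\<^sup>2 \<longrightarrow>
     measure M (S \<inter> {y\<in>l2space. l2dist x y \<le> \<epsilon>}) \<le> (6/7) ^ card (P m)"
    and s0: "s0 = \<alpha> / real d - (1/2 - inv_exp p)" "s0 > 0"
  shows "growth_order S M s0"
  unfolding growth_order_def
proof (intro allI impI)
  fix s assume s: "s0 < s"
  have d0: "real d > 0" using d_pos by simp
  have \<delta>: "real d * (s - s0) > 0" using s d0 by simp
  obtain c where c: "c > 0" "\<forall>m. c * 2 powr (- (\<alpha> - real d * (1/2 - inv_exp p) + real d * (s - s0)) * real m)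
    \<le> sqrt (ln (8/7) * real (card (P m))) * sign_radius p q \<alpha> P m"
    by (rule sign_radius_ge[OF \<delta>])
  have "\<alpha> - real d * (1/2 - inv_exp p) + real d * (s - s0) = real d * s"
    using d0 by (simp add: s0 field_simps)
  then have cm: "c * 2 powr (- (real d * s) * real m)
    \<le> sqrt (ln (8/7) * real (card (P m))) * sign_radius p q \<alpha> P m" for m using c(2) by simp
  define \<kappa> where "\<kappa> = log 2 (7/6)"
  have \<kappa>: "\<kappa> > 0" by (simp add: \<kappa>_def)
  \<comment> \<open>\<kappa> rewrites 6/7 as a power of 2, \<open>2 powr (- d)\<close> pays for
    rounding \<open>u\<close> down to \<open>m\<close>, and \<open>c powr (1 / s)\<close> comes from
    solving \<open>\<epsilon> = c * 2 powr (- d * s * u)\<close> for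
    \<open>2 powr (d * u)\<close>.\<close>
  define c' where "c' = \<kappa> * (a * 2 powr (- real d) * c powr (1 / s))"
  have "measure M (S \<inter> {y\<in>l2space. l2dist x y \<le> \<epsilon>}) \<le> 2 powr (- c' * \<epsilon> powr (- 1 / s))"
    if x: "x \<in> l2space" and \<epsilon>: "0 < \<epsilon>" "\<epsilon> < c" for x \<epsilon>
  proof -
    have ds: "real d * s > 0" using s s0 d0 by simp
    \<comment> \<open>The real block number at which \<open>c * 2 powr (- d * s * u)\<close> equals
      \<epsilon>; it is nonnegative because \<epsilon> stays below \<open>c\<close>, which therefore
      serves as the bound for small radii.\<close>
    define u where "u = log 2 (c / \<epsilon>) / (real d * s)"
    have u0: "0 \<le> u" using \<epsilon> ds by (simp add: u_def)
    have uc: "real d * s * u = log 2 (c / \<epsilon>)" using s s0 d0 by (simp add: u_def)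
    have u: "2 powr (- (real d * s) * u) = \<epsilon> / c"
    proof -
      have "2 powr (- (real d * s) * u) = inverse (2 powr (log 2 (c / \<epsilon>)))"
        by (simp only: uc[symmetric] powr_minus[symmetric] mult_minus_left)
      then show ?thesis using c \<epsilon> by simp
    qed
    define m where "m = nat \<lfloor>u\<rfloor>"
    have m: "real m \<le> u" "u < real m + 1" using u0 by (auto simp: m_def)
    have "\<epsilon> = c * 2 powr (- (real d * s) * u)" using c u by simp
    also have "\<dots> \<le> c * 2 powr (- (real d * s) * real m)"
    proof (rule mult_left_mono[OF powr_mono])
      have "real d * s * real m \<le> real d * s * u" using m ds by (intro mult_left_mono) auto
      then show "- (real d * s) * u \<le> - (real d * s) * real m" by simp
    qed (use c in auto)
    also note cm[of m]
    finally have "\<epsilon>\<^sup>2 \<le> (sqrt (ln (8/7) * real (card (P m))) * sign_radius p q \<alpha> P m)\<^sup>2"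
      using \<epsilon> by (intro power_mono) auto
    also have "\<dots> = ln (8/7) * real (card (P m)) * (sign_radius p q \<alpha> P m)\<^sup>2"
      by (simp add: power_mult_distrib)
    finally have "measure M (S \<inter> {y\<in>l2space. l2dist x y \<le> \<epsilon>}) \<le> (6/7) ^ card (P m)"
      using M x \<epsilon> by simp
    also have "(6/7 :: real) ^ card (P m) = 2 powr (- (\<kappa> * real (card (P m))))"
    proof -
      have "2 powr (- \<kappa>) = (6/7 :: real)" by (simp add: \<kappa>_def powr_minus)
      then have "(6/7 :: real) ^ card (P m) = (2 powr (- \<kappa>)) ^ card (P m)" by (simp only:)
      then show ?thesis by (simp add: powr_power mult.commute)
    qed
    also have "\<dots> \<le> 2 powr (- c' * \<epsilon> powr (- 1 / s))"
    proof (rule powr_mono)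
      have "c powr (1 / s) * \<epsilon> powr (- 1 / s) = (c / \<epsilon>) powr (1 / s)"
        using c \<epsilon> by (simp add: powr_divide powr_minus field_simps)
      also have "c / \<epsilon> = 2 powr (real d * s * u)" unfolding uc using c \<epsilon> by simp
      also have "(2 powr (real d * s * u)) powr (1 / s) = 2 powr (real d * u)"
        using s s0 by (simp add: powr_powr)
      finally have eq: "c powr (1 / s) * \<epsilon> powr (- 1 / s) = 2 powr (real d * u)" .
      have "a * 2 powr (- real d) * c powr (1 / s) * \<epsilon> powr (- 1 / s)
          = a * (2 powr (- real d) * (c powr (1 / s) * \<epsilon> powr (- 1 / s)))" by (simp only: mult_ac)
      also have "\<dots> = a * 2 powr (real d * u - real d)"
        unfolding eq by (simp add: powr_diff powr_minus_divide)
      also have "\<dots> \<le> a * 2 powr (real d * real m)"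
      proof (intro mult_left_mono powr_mono)
        have "real d * u \<le> real d * (real m + 1)" using m by (intro mult_left_mono) auto
        then show "real d * u - real d \<le> real d * real m" by (simp add: algebra_simps)
      qed (use a_pos in auto)
      also have "\<dots> \<le> real (card (P m))" using card_ge[of m] by (simp add: two_power_dm)
      finally have "\<kappa> * (a * 2 powr (- real d) * c powr (1 / s) * \<epsilon> powr (- 1 / s)) \<le> \<kappa> * real (card (P m))"
        using \<kappa> by (intro mult_left_mono) auto
      then show "- (\<kappa> * real (card (P m))) \<le> - c' * \<epsilon> powr (- 1 / s)" by (simp add: c'_def mult.assoc)
    qed auto
    finally show ?thesis .
  qed
  moreover have "c' > 0" using \<kappa> a_pos c by (simp add: c'_def)
  ultimately show "\<exists>\<epsilon>0>0. \<exists>c>0. \<forall>x\<in>l2space. \<forall>\<epsilon>. 0 < \<epsilon> \<and> \<epsilon> < \<epsilon>0 \<longrightarrow>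
        measure M (S \<inter> {y\<in>l2space. l2dist x y \<le> \<epsilon>}) \<le> 2 powr (- c * \<epsilon> powr (- 1 / s))"
    using c(1) by blast
qed

end

text \<open>Rounding the upper constant up to a natural number lets the sizes of codebooks be
  counted in \<open>nat\<close>.\<close>

lemma d_regular_regular_blocks:
  assumes "d_regular d P" "d \<ge> 1"
  obtains a A where "regular_blocks P d a A"
proof -
  obtain a A :: real where aA: "0 < a" "\<And>m. finite (P m)" "\<And>m. a * 2 ^ (d * m) \<le> real (card (P m))"
      "\<And>m. real (card (P m)) \<le> A * 2 ^ (d * m)" and part: "is_partition P"
    using assms(1) unfolding d_regular_def by metis
  define A' where "A' = nat \<lceil>A\<rceil>"
  have "card (P m) \<le> A' * 2 ^ (d * m)" for m
  proof -
    have "A \<le> real A'" unfolding A'_def by linarith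
    then have "A * 2 ^ (d * m) \<le> real A' * 2 ^ (d * m)" by (intro mult_right_mono) auto
    moreover have "real (A' * 2 ^ (d * m)) = real A' * 2 ^ (d * m)" by simp
    ultimately have "real (card (P m)) \<le> real (A' * 2 ^ (d * m))" using aA(4)[of m] by linarith
    then show ?thesis by (simp only: of_nat_le_iff)
  qed
  then have "regular_blocks P d a A'"
    using aA part assms(2) by unfold_locales (auto simp: is_partition_def)
  then show ?thesis by (rule that)
qed

theorem theorem3p3:
  fixes d :: nat and P :: "nat \<Rightarrow> 'i set" and p q :: ennreal and \<alpha> :: real
  assumes "countable (UNIV :: 'i set)" and "infinite (UNIV :: 'i set)"
    and "d \<ge> 1"
    and "d_regular d P"
    and "p > 0" and "q > 0"
    and "\<alpha> > real d * max 0 (1/2 - inv_exp p)"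
  shows "compactin l2top (mixed_unit_ball p q \<alpha> P)
       \<and> mixed_unit_ball p q \<alpha> P \<in> sets l2borel
       \<and> opt_rate (mixed_unit_ball p q \<alpha> P) = ereal (\<alpha> / real d - (1/2 - inv_exp p))
       \<and> (\<exists>M. borel_prob_on (mixed_unit_ball p q \<alpha> P) M \<and> critical (mixed_unit_ball p q \<alpha> P) M)"
proof -
  obtain a A where "regular_blocks P d a A"
    using assms(4,3) by (rule d_regular_regular_blocks)
  then interpret regular_blocks P d a A .
  define S where "S = mixed_unit_ball p q \<alpha> P"
  define s0 where "s0 = \<alpha> / real d - (1/2 - inv_exp p)"
  obtain r C \<beta> where r: "0 < r" "r \<le> 2" and C: "1 \<le> C" and \<beta>: "0 < \<beta>"
    and rate: "\<beta> / real d + 1 / r - 1 / 2 = s0" and sub: "S \<subseteq> block_ball P r (real C) \<beta>"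
    using mixed_unit_ball_subset_block_ball[OF assms(5,6,7)] unfolding S_def s0_def by metis
  have C0: "0 < real C" using C by simp
  have s0: "0 < s0"
  proof -
    have "0 < \<beta> / real d" using \<beta> d_pos by simp
    moreover have "1 / 2 \<le> 1 / r" using r by (simp add: field_simps)
    ultimately show ?thesis using rate by linarith
  qed
  have S2: "S \<subseteq> l2space" using sub block_ball_subset_l2space[OF r C0 \<beta>] by auto
  have comp: "compactin l2top S"
    using closed_mixed_unit_ball[OF assms(5,6)] sub r C0 \<beta> unfolding S_def by (rule compactin_l2top)
  have "closedin l2top S"
    using l2.Hausdorff_space_mtopology comp unfolding l2top_def by (rule compactin_imp_closedin)
  then have meas: "S \<in> sets l2borel" by (rule closedin_sets_l2borel)
  have "\<exists>M. borel_prob_on S M \<and> (\<forall>x\<in>l2space. \<forall>\<epsilon>\<ge>0. \<forall>m. \<epsilon>\<^sup>2 \<le> ln (8/7) * real (card (P m)) * (sign_radius p q \<alpha> P m)\<^sup>2 \<longrightarrow>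
     measure M (S \<inter> {y\<in>l2space. l2dist x y \<le> \<epsilon>}) \<le> (6/7) ^ card (P m))"
  proof (rule random_signs_measure)
    show "x \<in> S" if "\<And>m i. i \<in> P m \<Longrightarrow> \<bar>x i\<bar> \<le> sign_radius p q \<alpha> P m" for x
      unfolding S_def by (rule sign_box_subset_mixed_unit_ball[OF assms(5,6) that])
    show "summable (\<lambda>m. (real C * 2 powr (- \<beta> * real m))\<^sup>2)" by (rule summable_block_ball_bound[OF \<beta>])
    show "(\<Sum>i\<in>P m. (x i)\<^sup>2) \<le> (real C * 2 powr (- \<beta> * real m))\<^sup>2" if "x \<in> S" for x m
      using block_ball_sum_squares[OF _ r C0] sub that by blast
  qed (use assms(1) sign_radius_pos in auto)
  then obtain M where M: "borel_prob_on S M" and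
    small: "\<forall>x\<in>l2space. \<forall>\<epsilon>\<ge>0. \<forall>m. \<epsilon>\<^sup>2 \<le> ln (8/7) * real (card (P m)) * (sign_radius p q \<alpha> P m)\<^sup>2 \<longrightarrow>
     measure M (S \<inter> {y\<in>l2space. l2dist x y \<le> \<epsilon>}) \<le> (6/7) ^ card (P m)"
    by (elim exE conjE)
  \<comment> \<open>The same measure is used twice: it is the critical measure, and its small balls
    give the upper bound on the rate.\<close>
  have growth: "growth_order S M s0" by (rule growth_order_signs[OF small s0_def s0])
  have "opt_rate S = ereal s0"
    unfolding opt_rate_def
  proof (rule antisym)
    show "Sup (ereal ` {s. 0 \<le> s \<and> codec_achieves S s}) \<le> ereal s0"
      using growth_order_rate_le[OF M S2 growth] s0 by (auto intro!: Sup_least)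
    show "ereal s0 \<le> Sup (ereal ` {s. 0 \<le> s \<and> codec_achieves S s})"
    \<comment> \<open>A codec is constructed for each rate strictly between 0 and \<open>s0\<close>;
      these rates have supremum \<open>s0\<close>.\<close>
    proof (rule dense_le_bounded[of 0])
      show "(0::ereal) < ereal s0" using s0 by simp
      fix w assume w: "0 < w" "w < ereal s0"
      then obtain s where s: "w = ereal s" by (cases w) auto
      have "codec_achieves S s"
        using codec_achieves_block_ball[OF r C \<beta>, of s] w s rate
        by (intro codec_achieves_mono[OF sub]) auto
      then show "w \<le> Sup (ereal ` {s. 0 \<le> s \<and> codec_achieves S s})"
        using w s by (intro Sup_upper) auto
    qed
  qed
  then show ?thesis using comp meas M growth unfolding critical_def S_def s0_def by blast
qed

end
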